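(* Let $(\mathcal{G},\underline{a})$ be a finite metric graph and let $A,B$ be linear maps in $\mathcal{K}$ with $(A,\,B)\colon\mathcal{K}\oplus\mathcal{K}\to\mathcal{K}$ surjective and $AB^*$ self-adjoint, so that $-\Delta(A,B)$ is self-adjoint. Let $-\kappa_1^2\le\dots\le-\kappa_n^2<0$ be the negative eigenvalues of $-\Delta(A,B)$ counted with multiplicity, $\kappa_1\ge\dots\ge\kappa_n>0$, let $l_1\ge\dots\ge l_n>0$ be the positive eigenvalues of $L(0,\underline{a})$ and let $r_1\ge\dots\ge r_n>0$ be the $n$ largest positive eigenvalues of $R(0,\underline{a})$, all counted with multiplicity. Then $$l_i\le\kappa_i\le r_i,\qquad 1\le i\le n.$$
   Context: A finite metric graph consists of finitely many vertices, a finite set $\mathcal{I}$ of internal edges and a finite set $\mathcal{E}$ of external edges; each internal edge $i$ is identified with $[0,a_i]$, $a_i>0$, each external edge with $[0,\infty)$; $\underline{a}=\{a_i\}_{i\in\mathcal{I}}$. The Hilbert space is $\mathcal{H}=\bigoplus_{j}L^2(I_j)$. Let $\mathcal{D}$ be the set of $\psi\in\mathcal{H}$ with each $\psi_j,\psi_j'$ absolutely continuous and $\psi_j''\in L^2(I_j)$. Let $\mathcal{K}=\mathcal{K}_{\mathcal{E}}\oplus\mathcal{K}_{\mathcal{I}}^-\oplus\mathcal{K}_{\mathcal{I}}^+$ with $\mathcal{K}_{\mathcal{E}}\cong\mathbb{C}^{|\mathcal{E}|}$, $\mathcal{K}_{\mathcal{I}}^\pm\cong\mathbb{C}^{|\mathcal{I}|}$,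 and for $\psi\in\mathcal{D}$ set $\underline{\psi}=(\{\psi_e(0)\}_{e},\{\psi_i(0)\}_{i},\{\psi_i(a_i)\}_{i})$, $\underline{\psi'}=(\{\psi_e'(0)\}_{e},\{\psi_i'(0)\}_{i},\{-\psi_i'(a_i)\}_{i})$. The operator $\Delta(A,B)$ acts by $(\Delta\psi)_j=\psi_j''$ on $\{\psi\in\mathcal{D}: A\underline{\psi}+B\underline{\psi'}=0\}$. Let $P$ be the orthogonal projector onto $\operatorname{Ker}B$, $P^\perp=1-P$, and $L=(B|_{\operatorname{Ran}B^*})^{-1}AP^\perp$, a Hermitian operator in $\operatorname{Ran}P^\perp$. With respect to the decomposition of $\mathcal{K}$, let $$M(0,\underline{a})=\begin{bmatrix}0&0&0\\0&-\frac{1}{\underline{a}}&\frac{1}{\underline{a}}\\0&\frac{1}{\underline{a}}&-\frac{1}{\underline{a}}\end{bmatrix},\qquad M_1(\underline{a})=\begin{bmatrix}0&0&0\\0&\frac{1}{\underline{a}}&\frac{1}{\underline{a}}\\0&\frac{1}{\underline{a}}&\frac{1}{\underline{a}}\end{bmatrix},$$ where $\frac1{\underline a}$ is the diagonal matrix with entries $1/a_i$, and let $L(0,\underline{a})=L+P^\perp M(0,\underline{a})P^\perp$ and $R(0,\underline{a})=L+P^\perp M_1(\underline{a})P^\perp$, both regarded as Hermitian operators in $\operatorname{Ran}P^\perp$. (It is known that the number $n$ of negative eigenvalues of $-\Delta(A,B)$ equals the number of positive eigenvalues of $L(0,\underline{a})$; since $L(0,\underline a)\le R(0,\underline a)$,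 $R(0,\underline{a})$ has at least $n$ positive eigenvalues.) *)

theory Defs
  imports "HOL-Analysis.Analysis" "HOL-Library.Function_Algebras"
begin

(* ------------------------------------------------------------------
   Conventions.
   A finite metric graph has m external edges (indices j < m, each a copy
   of [0,oo)) and k internal edges; internal edge q < k has length a q > 0
   and carries the global edge index j = m + q (a copy of [0, a q]).
   Elements of H are functions psi :: nat => real => complex, vanishing
   outside their edge interval and for j >= m + k.
   K = C^m + C^k + C^k is realised as functions nat => complex supported
   in {..< N}, N = m + 2k: coordinates i < m are external, m <= i < m+k
   are the internal edges at 0, m+k <= i < N the internal edges at a.
   Linear maps in K are N x N matrices given as nat => nat => complex.
   ------------------------------------------------------------------ *)

definition Kdim :: "nat \<Rightarrow> nat \<Rightarrow> nat" where
  "Kdim m k = m + 2 * k"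

definition edge_int :: "nat \<Rightarrow> (nat \<Rightarrow> real) \<Rightarrow> nat \<Rightarrow> real set" where
  "edge_int m a j = (if j < m then {0..} else {0 .. a (j - m)})"

definition L2_on :: "(real \<Rightarrow> complex) \<Rightarrow> real set \<Rightarrow> bool" where
  "L2_on f S \<longleftrightarrow> f \<in> borel_measurable (lebesgue_on S)
     \<and> integrable (lebesgue_on S) (\<lambda>x. (cmod (f x))\<^sup>2)"

text \<open>psi belongs to H and to the domain D, with psi1 (continuous) first and
  psi2 second derivative: psi and psi1 are absolutely continuous (indefinite
  integrals of psi1, resp. psi2), and psi2 is square integrable.\<close>
definition in_D :: "nat \<Rightarrow> nat \<Rightarrow> (nat \<Rightarrow> real) \<Rightarrow>
    (nat \<Rightarrow> real \<Rightarrow> complex) \<Rightarrow> (nat \<Rightarrow> real \<Rightarrow> complex) \<Rightarrow> (nat \<Rightarrow> real \<Rightarrow> complex) \<Rightarrow> bool" where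
  "in_D m k a psi psi1 psi2 \<longleftrightarrow>
     (\<forall>j x. (m + k \<le> j \<or> x \<notin> edge_int m a j) \<longrightarrow> psi j x = 0) \<and>
     (\<forall>j < m + k.
        L2_on (psi j) (edge_int m a j) \<and> L2_on (psi2 j) (edge_int m a j) \<and>
        (\<forall>x \<in> edge_int m a j.
           (psi2 j has_integral (psi1 j x - psi1 j 0)) {0..x} \<and>
           (psi1 j has_integral (psi j x - psi j 0)) {0..x}))"

definition bval :: "nat \<Rightarrow> nat \<Rightarrow> (nat \<Rightarrow> real) \<Rightarrow> (nat \<Rightarrow> real \<Rightarrow> complex) \<Rightarrow> nat \<Rightarrow> complex" where
  "bval m k a psi i =
     (if i < m + k then psi i 0
      else if i < m + 2 * k then psi (i - k) (a (i - m - k)) else 0)"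

definition bder :: "nat \<Rightarrow> nat \<Rightarrow> (nat \<Rightarrow> real) \<Rightarrow> (nat \<Rightarrow> real \<Rightarrow> complex) \<Rightarrow> nat \<Rightarrow> complex" where
  "bder m k a psi1 i =
     (if i < m + k then psi1 i 0
      else if i < m + 2 * k then - psi1 (i - k) (a (i - m - k)) else 0)"

definition mv :: "nat \<Rightarrow> (nat \<Rightarrow> nat \<Rightarrow> complex) \<Rightarrow> (nat \<Rightarrow> complex) \<Rightarrow> nat \<Rightarrow> complex" where
  "mv N A x = (\<lambda>i. if i < N then (\<Sum>j<N. A i j * x j) else 0)"

definition Kvecs :: "nat \<Rightarrow> (nat \<Rightarrow> complex) set" where
  "Kvecs N = {x. \<forall>i\<ge>N. x i = 0}"

definition madj :: "(nat \<Rightarrow> nat \<Rightarrow> complex) \<Rightarrow> nat \<Rightarrow> nat \<Rightarrow> complex" where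
  "madj B = (\<lambda>i j. cnj (B j i))"

definition kinner :: "nat \<Rightarrow> (nat \<Rightarrow> complex) \<Rightarrow> (nat \<Rightarrow> complex) \<Rightarrow> complex" where
  "kinner N x y = (\<Sum>i<N. x i * cnj (y i))"

definition scaleH :: "complex \<Rightarrow> (nat \<Rightarrow> real \<Rightarrow> complex) \<Rightarrow> (nat \<Rightarrow> real \<Rightarrow> complex)" where
  "scaleH c psi = (\<lambda>j x. c * psi j x)"

definition scaleK :: "complex \<Rightarrow> (nat \<Rightarrow> complex) \<Rightarrow> (nat \<Rightarrow> complex)" where
  "scaleK c x = (\<lambda>i. c * x i)"

definition Delta_eigenspace :: "nat \<Rightarrow> nat \<Rightarrow> (nat \<Rightarrow> real) \<Rightarrow>
    (nat \<Rightarrow> nat \<Rightarrow> complex) \<Rightarrow> (nat \<Rightarrow> nat \<Rightarrow> complex) \<Rightarrow> real \<Rightarrow> (nat \<Rightarrow> real \<Rightarrow> complex) set" where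
  "Delta_eigenspace m k a A B lam =
     {psi. \<exists>psi1 psi2. in_D m k a psi psi1 psi2 \<and>
        mv (Kdim m k) A (bval m k a psi) + mv (Kdim m k) B (bder m k a psi1) = (\<lambda>_. 0) \<and>
        (\<forall>j < m + k. AE x in lebesgue_on (edge_int m a j).
            - psi2 j x = complex_of_real lam * psi j x)}"

text \<open>Ran P^perp = (Ker B)^perp = Ran B^*, and the orthogonal projector onto it\<close>
definition RanPperp :: "nat \<Rightarrow> (nat \<Rightarrow> nat \<Rightarrow> complex) \<Rightarrow> (nat \<Rightarrow> complex) set" where
  "RanPperp N B = (\<lambda>y. mv N (madj B) y) ` Kvecs N"

definition Pperp :: "nat \<Rightarrow> (nat \<Rightarrow> nat \<Rightarrow> complex) \<Rightarrow> (nat \<Rightarrow> complex) \<Rightarrow> nat \<Rightarrow> complex" where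
  "Pperp N B x = (THE w. w \<in> RanPperp N B \<and> (\<forall>u \<in> RanPperp N B. kinner N (x - w) u = 0))"

definition Lop :: "nat \<Rightarrow> (nat \<Rightarrow> nat \<Rightarrow> complex) \<Rightarrow> (nat \<Rightarrow> nat \<Rightarrow> complex) \<Rightarrow> (nat \<Rightarrow> complex) \<Rightarrow> nat \<Rightarrow> complex" where
  "Lop N A B x = (THE y. y \<in> RanPperp N B \<and> mv N B y = mv N A (Pperp N B x))"

definition M0 :: "nat \<Rightarrow> nat \<Rightarrow> (nat \<Rightarrow> real) \<Rightarrow> (nat \<Rightarrow> complex) \<Rightarrow> nat \<Rightarrow> complex" where
  "M0 m k a x = (\<lambda>i.
     if i < m then 0
     else if i < m + k then (- x i + x (i + k)) / complex_of_real (a (i - m))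
     else if i < m + 2 * k then (x (i - k) - x i) / complex_of_real (a (i - m - k))
     else 0)"

definition M1 :: "nat \<Rightarrow> nat \<Rightarrow> (nat \<Rightarrow> real) \<Rightarrow> (nat \<Rightarrow> complex) \<Rightarrow> nat \<Rightarrow> complex" where
  "M1 m k a x = (\<lambda>i.
     if i < m then 0
     else if i < m + k then (x i + x (i + k)) / complex_of_real (a (i - m))
     else if i < m + 2 * k then (x (i - k) + x i) / complex_of_real (a (i - m - k))
     else 0)"

definition L0a where
  "L0a m k a A B x = Lop (Kdim m k) A B x + Pperp (Kdim m k) B (M0 m k a (Pperp (Kdim m k) B x))"

definition R0a where
  "R0a m k a A B x = Lop (Kdim m k) A B x + Pperp (Kdim m k) B (M1 m k a (Pperp (Kdim m k) B x))"

definition op_eigenspace :: "((nat \<Rightarrow> complex) \<Rightarrow> nat \<Rightarrow> complex) \<Rightarrow> (nat \<Rightarrow> complex) set \<Rightarrow> real \<Rightarrow> (nat \<Rightarrow> complex) set" where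
  "op_eigenspace T V lam = {x \<in> V. T x = scaleK (complex_of_real lam) x}"

definition pos_eigs_list :: "((nat \<Rightarrow> complex) \<Rightarrow> nat \<Rightarrow> complex) \<Rightarrow> (nat \<Rightarrow> complex) set \<Rightarrow> real list \<Rightarrow> bool" where
  "pos_eigs_list T V ls \<longleftrightarrow> sorted_wrt (\<ge>) ls \<and> (\<forall>l \<in> set ls. l > 0) \<and>
     (\<forall>lam > 0. count (mset ls) lam = vector_space.dim scaleK (op_eigenspace T V lam))"

definition neg_eigs_kappas where
  "neg_eigs_kappas m k a A B ks \<longleftrightarrow> sorted_wrt (\<ge>) ks \<and> (\<forall>x \<in> set ks. x > 0) \<and>
     (\<forall>kap > 0. count (mset ks) kap =
        vector_space.dim scaleH (Delta_eigenspace m k a A B (- kap\<^sup>2)))"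

end

theory Submission
  imports Defs "HOL-Computational_Algebra.Fundamental_Theorem_Algebra"
begin

text \<open>
  An eigenfunction for \<open>-\<kappa>\<^sup>2\<close> is a combination of \<open>e\<^sup>\<kappa>\<^sup>t\<close> and \<open>e\<^sup>-\<^sup>\<kappa>\<^sup>t\<close> on every edge, hence
  determined by its boundary values \<open>x\<close>, and its boundary derivatives are \<open>M(\<kappa>) x\<close> for a
  Dirichlet-to-Neumann matrix \<open>M(\<kappa>)\<close>. The boundary condition becomes \<open>L(\<kappa>) x = 0\<close> with
  \<open>L(\<kappa>) = L + P\<^sup>\<bottom> M(\<kappa>) P\<^sup>\<bottom>\<close>. As \<open>M(\<kappa>)\<close> is strictly decreasing and continuous in \<open>\<kappa>\<close>,
  the number of \<open>\<kappa>\<^sub>i \<ge> \<kappa>\<close> equals the number of nonnegative eigenvalues of \<open>L(\<kappa>)\<close>.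
  On even and odd vectors of an internal edge of length \<open>l\<close>, \<open>M(\<kappa>)\<close> is \<open>-\<kappa> tanh (\<kappa>l/2)\<close> and
  \<open>-\<kappa> coth (\<kappa>l/2)\<close>, so that \<open>M(0,a) - \<kappa> \<le> M(\<kappa>) \<le> M\<^sub>1(a) - \<kappa>\<close>. Comparing the eigenvalue
  counts of \<open>L(0,a) - \<kappa>\<close>, \<open>L(\<kappa>)\<close> and \<open>R(0,a) - \<kappa>\<close> gives both bounds.
\<close>

text \<open>Eigenvalue branches of \<open>L(\<kappa>)\<close> are never followed. Everything is
  expressed by the integer \<open>count_ge\<close>, because a single form inequality T - c \<le> S -
  d on \<open>V\<close> already bounds the count of T at c by the count of S at d; the shift c
  absorbs the -\<kappa> in the two bounds. All matrices to be compared are diagonal in the same even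
  and odd combinations, so each such inequality is a finite list of scalar ones. Continuity enters
  the same way: the coefficients are moved by less than a spectral gap around 0. The obstacle is
  that the \<kappa>'s are known only through dimensions of eigenspaces, one value at a time. Strict
  monotonicity makes all eigenvalues of \<open>L(\<kappa>)\<close> cross 0 in the same direction, so
  the drop of the count at \<kappa> is exactly the dimension of the kernel of
  \<open>L(\<kappa>)\<close> and crossings cannot cancel. That L(0,a) has enough positive
  eigenvalues for all the lower bounds to make sense is a separate point, which rests on the strict
  inequality M(\<kappa>) < M(0,a).\<close>

section \<open>Hermitian operators on subspaces of \<open>K\<close>\<close>

text \<open>With these two rules the simplifier turns sums of vectors into \<open>\<lambda>\<close>-abstractions.\<close>
declare plus_fun_apply [simp del] zero_fun_apply [simp del]

lemmas fun_apply = plus_fun_apply zero_fun_apply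

interpretation K: vector_space scaleK
  by standard (auto simp: scaleK_def fun_eq_iff fun_apply algebra_simps)

interpretation H: vector_space scaleH
  by standard (auto simp: scaleH_def fun_eq_iff fun_apply algebra_simps)

lemma kinner_add_left: "kinner N (x + y) z = kinner N x z + kinner N y z"
  by (simp add: kinner_def fun_apply algebra_simps sum.distrib)

lemma kinner_diff_left: "kinner N (x - y) z = kinner N x z - kinner N y z"
  by (simp add: kinner_def algebra_simps sum_subtractf)

lemma kinner_scale_left: "kinner N (scaleK c x) z = c * kinner N x z"
  by (simp add: kinner_def scaleK_def sum_distrib_left algebra_simps)

lemma kinner_add_right: "kinner N x (y + z) = kinner N x y + kinner N x z"
  by (simp add: kinner_def fun_apply algebra_simps sum.distrib)

lemma kinner_scale_right: "kinner N x (scaleK c z) = cnj c * kinner N x z"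
  by (simp add: kinner_def scaleK_def sum_distrib_left algebra_simps)

lemma kinner_zero [simp]: "kinner N 0 x = 0" "kinner N x 0 = 0"
  by (simp_all add: kinner_def fun_apply)

lemma kinner_commute: "kinner N y x = cnj (kinner N x y)"
  by (simp add: kinner_def mult.commute)

lemma kinner_eq_0_commute: "kinner N x y = 0 \<Longrightarrow> kinner N y x = 0"
  by (simp add: kinner_commute[of N y x])

lemma kinner_sum_left: "kinner N (\<Sum>e\<in>S. f e) z = (\<Sum>e\<in>S. kinner N (f e) z)"
  by (induction S rule: infinite_finite_induct) (auto simp: kinner_add_left)

lemma kinner_sum_right: "kinner N z (\<Sum>e\<in>S. f e) = (\<Sum>e\<in>S. kinner N z (f e))"
  by (induction S rule: infinite_finite_induct) (auto simp: kinner_add_right)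

lemma kinner_self: "kinner N x x = of_real (\<Sum>i<N. (cmod (x i))\<^sup>2)"
  by (simp add: kinner_def complex_norm_square del: of_real_power)

lemma Re_kinner_self_nonneg: "0 \<le> Re (kinner N x x)"
  by (simp add: kinner_self sum_nonneg)

lemma kinner_self_eq_Re: "kinner N x x = of_real (Re (kinner N x x))"
  by (simp add: kinner_self)

text \<open>Vectors are functions on all of \<open>nat\<close>, while \<open>kinner\<close> sees
  only the coordinates below \<open>N\<close>; definiteness therefore needs
  \<open>Kvecs N\<close>.\<close>

lemma kinner_self_eq_0_iff: "x \<in> Kvecs N \<Longrightarrow> kinner N x x = 0 \<longleftrightarrow> x = 0"
  by (auto simp: kinner_self Kvecs_def fun_eq_iff fun_apply sum_nonneg_eq_0_iff simp flip: of_real_sum)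
     (metis lessThan_iff not_le)

lemma Re_kinner_self_pos: "x \<in> Kvecs N \<Longrightarrow> x \<noteq> 0 \<Longrightarrow> 0 < Re (kinner N x x)"
  by (metis Re_kinner_self_nonneg kinner_self_eq_0_iff kinner_self_eq_Re less_eq_real_def of_real_0)

lemma subspace_Kvecs: "K.subspace (Kvecs N)"
  by (auto simp: K.subspace_def Kvecs_def scaleK_def fun_apply)

text \<open>The vectors are not normalised, which keeps square roots out of the expansions;
  excluding 0 is what makes such a set independent.\<close>

definition korthogonal :: "nat \<Rightarrow> (nat \<Rightarrow> complex) set \<Rightarrow> bool" where
  "korthogonal N E \<longleftrightarrow> finite E \<and> E \<subseteq> Kvecs N \<and> 0 \<notin> E \<and>
     (\<forall>x\<in>E. \<forall>y\<in>E. x \<noteq> y \<longrightarrow> kinner N x y = 0)"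

lemma korthogonal_subset: "korthogonal N E \<Longrightarrow> S \<subseteq> E \<Longrightarrow> korthogonal N S"
  by (auto simp: korthogonal_def intro: finite_subset)

lemma kinner_sum_orthogonal:
  assumes "korthogonal N E" "y \<in> E"
  shows "kinner N (\<Sum>e\<in>E. scaleK (u e) e) y = u y * kinner N y y"
proof -
  have "kinner N (\<Sum>e\<in>E. scaleK (u e) e) y = (\<Sum>e\<in>E. if e = y then u y * kinner N y y else 0)"
    unfolding kinner_sum_left kinner_scale_left
    using assms by (intro sum.cong) (auto simp: korthogonal_def)
  then show ?thesis using assms by (simp add: korthogonal_def)
qed

lemma kinner_sum_sum_orthogonal:
  assumes "korthogonal N E"
  shows "kinner N (\<Sum>e\<in>E. scaleK (u e) e) (\<Sum>e\<in>E. scaleK (w e) e) =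
    (\<Sum>e\<in>E. u e * cnj (w e) * kinner N e e)"
  unfolding kinner_sum_right kinner_scale_right
  using assms by (intro sum.cong) (auto simp: kinner_sum_orthogonal)

lemma korthogonal_independent:
  assumes "korthogonal N E" shows "K.independent E"
proof (rule K.independent_if_scalars_zero)
  show "finite E" using assms by (simp add: korthogonal_def)
next
  fix f x assume s: "(\<Sum>x\<in>E. scaleK (f x) x) = 0" and x: "x \<in> E"
  have "f x * kinner N x x = 0"
    using kinner_sum_orthogonal[OF assms x, of f] s by simp
  moreover have "kinner N x x \<noteq> 0"
    using assms x kinner_self_eq_0_iff by (auto simp: korthogonal_def)
  ultimately show "f x = 0" by simp
qed

lemma Kvecs_spanning_set:
  obtains S where "finite S" "card S \<le> N" "Kvecs N \<subseteq> K.span S"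
proof
  define b :: "nat \<Rightarrow> nat \<Rightarrow> complex" where "b i = (\<lambda>j. if j = i then 1 else 0)" for i
  show "finite (b ` {..<N})" by simp
  show "card (b ` {..<N}) \<le> N" using card_image_le[of "{..<N}" b] by simp
  show "Kvecs N \<subseteq> K.span (b ` {..<N})"
  proof
    fix x assume x: "x \<in> Kvecs N"
    have "x = (\<Sum>i<N. scaleK (x i) (b i))"
    proof
      fix j
      have "(\<Sum>i<N. scaleK (x i) (b i)) j = (\<Sum>i<N. x i * b i j)"
        by (induction N) (auto simp: scaleK_def fun_apply)
      also have "\<dots> = x j" using x by (auto simp: b_def Kvecs_def sum.delta if_distrib cong: if_cong)
      finally show "x j = (\<Sum>i<N. scaleK (x i) (b i)) j" by simp
    qed
    also have "\<dots> \<in> K.span (b ` {..<N})"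
      by (intro K.span_sum K.span_scale K.span_base) auto
    finally show "x \<in> K.span (b ` {..<N})" .
  qed
qed

text \<open>The ambient space of \<open>scaleK\<close> is infinite-dimensional, so every later
  finiteness argument draws on this bound.\<close>

lemma independent_Kvecs_bound:
  assumes "K.independent E" "E \<subseteq> Kvecs N"
  shows "finite E" "card E \<le> N"
proof -
  obtain S where "finite S" "card S \<le> N" "Kvecs N \<subseteq> K.span S"
    by (rule Kvecs_spanning_set)
  then show "finite E" "card E \<le> N"
    using K.independent_span_bound[of S E] assms by force+
qed

text \<open>The image of a basis is independent and of the same size; a vector outside its span
  would extend it to an independent set larger than the basis.\<close>

lemma linear_inj_imp_surj_Kvecs:
  assumes lin: "Vector_Spaces.linear scaleK scaleK f" and into: "f ` Kvecs N \<subseteq> Kvecs N"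
    and inj: "\<And>x. x \<in> Kvecs N \<Longrightarrow> f x = 0 \<Longrightarrow> x = 0"
  shows "f ` Kvecs N = Kvecs N"
proof -
  interpret f: Vector_Spaces.linear scaleK scaleK f by fact
  obtain B where B: "B \<subseteq> Kvecs N" "K.independent B" "Kvecs N \<subseteq> K.span B"
    by (metis K.basis_exists)
  have spB: "K.span B = Kvecs N"
    using B subspace_Kvecs by (metis K.span_minimal subset_antisym)
  have finB: "finite B" using independent_Kvecs_bound B by blast
  have injB: "inj_on f (K.span B)"
  proof (rule inj_onI)
    fix x y assume xy: "x \<in> K.span B" "y \<in> K.span B" "f x = f y"
    then have "f (x - y) = 0" by (simp add: f.diff)
    then show "x = y" using inj[of "x - y"] xy spB subspace_Kvecs K.subspace_diff by auto
  qed
  have ind: "K.independent (f ` B)"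
    using f.independent_injective_image[OF B(2) injB] .
  have cardB: "card (f ` B) = card B"
    using injB by (meson card_image inj_on_subset K.span_superset)
  have fB: "f ` B \<subseteq> Kvecs N" using B into by auto
  have "Kvecs N \<subseteq> K.span (f ` B)"
  proof
    fix y assume y: "y \<in> Kvecs N"
    show "y \<in> K.span (f ` B)"
    proof (rule ccontr)
      assume n: "y \<notin> K.span (f ` B)"
      then have "K.independent (insert y (f ` B))" using ind by (rule K.independent_insertI)
      moreover have "insert y (f ` B) \<subseteq> K.span B" using y fB spB by auto
      ultimately have "card (insert y (f ` B)) \<le> card B"
        using K.independent_span_bound[OF finB] by blast
      moreover have "y \<notin> f ` B" using n K.span_base by blast
      ultimately show False using cardB finB by simp
    qed
  qed
  then show ?thesis using into f.span_image[of B] spB by auto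
qed

section \<open>Polynomials in an operator and the existence of eigenvectors\<close>

definition poly_apply :: "((nat \<Rightarrow> complex) \<Rightarrow> nat \<Rightarrow> complex) \<Rightarrow> (nat \<Rightarrow> complex) \<Rightarrow> complex poly \<Rightarrow> nat \<Rightarrow> complex"
  where "poly_apply T x p = fold_coeffs (\<lambda>c y. scaleK c x + T y) p 0"

locale hermitian_on =
  fixes N :: nat and V :: "(nat \<Rightarrow> complex) set" and T :: "(nat \<Rightarrow> complex) \<Rightarrow> nat \<Rightarrow> complex"
  assumes subspace: "K.subspace V"
    and carrier: "V \<subseteq> Kvecs N"
    and closed: "x \<in> V \<Longrightarrow> T x \<in> V"
    and add: "x \<in> V \<Longrightarrow> y \<in> V \<Longrightarrow> T (x + y) = T x + T y"
    and scale: "x \<in> V \<Longrightarrow> T (scaleK c x) = scaleK c (T x)"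
    and hermitian: "x \<in> V \<Longrightarrow> y \<in> V \<Longrightarrow> kinner N (T x) y = kinner N x (T y)"
begin

lemma zero: "T 0 = 0"
  using scale[of 0 0] K.subspace_0[OF subspace] by simp

lemma sum: "(\<And>e. e \<in> S \<Longrightarrow> f e \<in> V) \<Longrightarrow> T (\<Sum>e\<in>S. f e) = (\<Sum>e\<in>S. T (f e))"
proof (induction S rule: infinite_finite_induct)
  case (insert x S)
  then show ?case by (simp add: add K.subspace_sum[OF subspace])
qed (simp_all add: zero)

text \<open>\<open>poly_apply\<close> is Horner's rule for p(T) x. The case p = 0, c = 0 stands
  apart because \<open>pCons 0 0\<close> is 0, and the claim then reads T 0 = 0.\<close>

lemma poly_apply_pCons: "poly_apply T x (pCons c p) = scaleK c x + T (poly_apply T x p)"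
  by (cases "p = 0 \<and> c = 0") (auto simp: poly_apply_def zero)

lemma poly_apply_0: "poly_apply T x 0 = 0"
  by (simp add: poly_apply_def)

lemma poly_apply_in:
  assumes "x \<in> V" shows "poly_apply T x p \<in> V"
  by (induction p)
     (auto simp: poly_apply_0 poly_apply_pCons closed K.subspace_0[OF subspace]
        intro!: K.subspace_add[OF subspace] K.subspace_scale[OF subspace] assms)

lemma poly_apply_add:
  assumes "x \<in> V" shows "poly_apply T x (p + q) = poly_apply T x p + poly_apply T x q"
proof (induction p q rule: poly_induct2)
  case (pCons a p b q)
  then show ?case
    by (simp add: poly_apply_pCons add poly_apply_in assms K.scale_left_distrib)
qed (simp add: poly_apply_0)

lemma poly_apply_smult:
  assumes "x \<in> V" shows "poly_apply T x (smult c p) = scaleK c (poly_apply T x p)"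
  by (induction p)
     (auto simp: poly_apply_0 poly_apply_pCons scale poly_apply_in assms K.scale_right_distrib)

lemma poly_apply_monom: "poly_apply T x (monom 1 j) = (T ^^ j) x"
  by (induction j) (auto simp: monom_0 monom_Suc poly_apply_pCons poly_apply_0 zero)

text \<open>Vanishing coefficients from \<open>i\<close> on, instead of degree below
  \<open>i\<close>, include the case i = 0, where q = 0.\<close>

lemma poly_apply_span_iterates:
  assumes "x \<in> V" "y \<in> K.span ((\<lambda>j. (T ^^ j) x) ` {..<i})"
  shows "\<exists>q. (\<forall>n\<ge>i. coeff q n = 0) \<and> poly_apply T x q = y"
  using assms(2)
proof (induction rule: K.span_induct_alt)
  case base then show ?case by (intro exI[of _ 0]) (simp add: poly_apply_0)
next
  case (step c z y)
  then obtain j q where j: "j < i" "z = (T ^^ j) x"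
    and q: "\<forall>n\<ge>i. coeff q n = 0" "poly_apply T x q = y" by auto
  show ?case
    using j q by (intro exI[of _ "smult c (monom 1 j) + q"])
      (auto simp: poly_apply_add[OF assms(1)] poly_apply_smult[OF assms(1)] poly_apply_monom)
qed

text \<open>Among N + 1 iterates of x one depends on its predecessors. Moving it to the other side
  of that relation gives a polynomial with coefficient 1 at \<open>i\<close>, hence a nonzero
  one.\<close>

lemma annihilating_poly_exists:
  assumes "x \<in> V" shows "\<exists>p. p \<noteq> 0 \<and> poly_apply T x p = 0"
proof -
  define v where "v j = (T ^^ j) x" for j
  have vV: "v j \<in> V" for j unfolding v_def using assms closed by (induction j) auto
  have "\<exists>i. v i \<in> K.span (v ` {..<i})"
  proof (rule ccontr)
    assume "\<not> ?thesis"
    then have n: "v i \<notin> K.span (v ` {..<i})" for i by blast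
    have "K.independent (v ` {..<i}) \<and> card (v ` {..<i}) = i" for i
    proof (induction i)
      case (Suc i)
      have "v i \<notin> v ` {..<i}" using n[of i] K.span_base by metis
      then show ?case using Suc n[of i]
        by (simp add: lessThan_Suc K.independent_insert)
    qed (auto simp: K.independent_empty)
    from this[of "Suc N"] independent_Kvecs_bound(2)[of "v ` {..<Suc N}" N]
    show False using vV carrier by force
  qed
  then obtain i q where q: "\<forall>n\<ge>i. coeff q n = 0" "poly_apply T x q = v i"
    using poly_apply_span_iterates[OF assms] unfolding v_def by blast
  show ?thesis
  proof (intro exI conjI)
    show "monom 1 i + smult (-1) q \<noteq> 0"
    proof
      assume "monom 1 i + smult (-1) q = 0"
      then have "coeff (monom 1 i + smult (-1) q) i = 0" by simp
      then show False using q by simp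
    qed
    show "poly_apply T x (monom 1 i + smult (-1) q) = 0"
      unfolding poly_apply_add[OF assms] poly_apply_smult[OF assms] q(2) poly_apply_monom v_def
      by (simp add: scaleK_def fun_eq_iff fun_apply)
  qed
qed

text \<open>An annihilating polynomial of least degree factors as \<open>(X - c) q\<close> over the complex
  numbers, and \<open>q(T) x\<close> is then an eigenvector.\<close>
lemma eigenvector_exists:
  assumes "V \<noteq> {0}"
  shows "\<exists>y \<mu>. y \<in> V \<and> y \<noteq> 0 \<and> T y = scaleK (complex_of_real \<mu>) y"
proof -
  obtain x where x: "x \<in> V" "x \<noteq> 0" using assms K.subspace_0[OF subspace] by blast
  let ?P = "\<lambda>p. p \<noteq> 0 \<and> poly_apply T x p = 0"
  obtain p where p: "?P p" and pmin: "\<And>q. ?P q \<Longrightarrow> degree p \<le> degree q"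
    using annihilating_poly_exists[OF x(1)] ex_has_least_nat[of ?P _ degree] by blast
  have "degree p \<noteq> 0"
  proof
    assume "degree p = 0"
    then obtain c where c: "p = [:c:]" by (metis degree_eq_zeroE)
    then show False using p x by (auto simp: poly_apply_pCons poly_apply_0 zero)
  qed
  then obtain c where "poly p c = 0"
    using fundamental_theorem_of_algebra[of p] by (auto simp: constant_degree)
  then obtain q where q: "p = [:- c, 1:] * q" by (metis dvdE poly_eq_0_iff_dvd)
  have qn: "q \<noteq> 0" using p q by auto
  have "degree p = Suc (degree q)" unfolding q using qn by (subst degree_mult_eq) auto
  then have y0: "poly_apply T x q \<noteq> 0" using pmin[of q] qn by auto
  define y where "y = poly_apply T x q"
  have yV: "y \<in> V" using poly_apply_in x y_def by simp
  have "p = smult (- c) q + pCons 0 q" using q by simp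
  then have "0 = scaleK (- c) y + T y"
    using p poly_apply_add[OF x(1)] poly_apply_smult[OF x(1)]
    by (metis K.scale_zero_left add_0 poly_apply_pCons y_def)
  then have ev: "T y = scaleK c y" by (simp add: eq_neg_iff_add_eq_0 add.commute)
  have "c * kinner N y y = cnj c * kinner N y y"
    using hermitian[OF yV yV] by (simp add: ev kinner_scale_left kinner_scale_right)
  moreover have "kinner N y y \<noteq> 0"
    using kinner_self_eq_0_iff yV carrier y0 y_def by blast
  ultimately have "c = cnj c" by simp
  then have "c = of_real (Re c)" by (metis Reals_cnj_iff of_real_Re)
  then show ?thesis using ev yV y0 y_def by metis
qed

section \<open>Orthogonal eigenbases and eigenspaces\<close>

definition eigenbasis :: "(nat \<Rightarrow> complex) set \<Rightarrow> bool" where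
  "eigenbasis E \<longleftrightarrow> korthogonal N E \<and> K.span E = V \<and>
     (\<forall>e\<in>E. \<exists>\<mu>. T e = scaleK (complex_of_real \<mu>) e)"

text \<open>Take an orthogonal set of eigenvectors of greatest size. Its orthogonal complement
  \<open>U\<close> in \<open>V\<close> is invariant, so \<open>T\<close> is again Hermitian there,
  and an eigenvector in \<open>U\<close> would enlarge the set. Hence \<open>U\<close> is
  trivial.\<close>

theorem eigenbasis_exists: "\<exists>E. eigenbasis E"
proof -
  define Q where "Q E \<longleftrightarrow> korthogonal N E \<and> E \<subseteq> V \<and>
     (\<forall>e\<in>E. \<exists>\<mu>. T e = scaleK (complex_of_real \<mu>) e)" for E
  have bound: "card E \<le> N" if "Q E" for E
    using that korthogonal_independent[of N E] independent_Kvecs_bound[of E N]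
    by (auto simp: Q_def korthogonal_def)
  have "Q {}" by (simp add: Q_def korthogonal_def)
  then obtain E where E: "Q E" and Emax: "\<And>F. Q F \<Longrightarrow> card F \<le> card E"
    using ex_has_greatest_nat[of Q "{}" card "Suc N"] bound by (auto simp: less_Suc_eq_le)
  have oE: "korthogonal N E" and EV: "E \<subseteq> V"
    and eE: "\<forall>e\<in>E. \<exists>\<mu>. T e = scaleK (complex_of_real \<mu>) e"
    using E by (auto simp: Q_def)
  define U where "U = {x \<in> V. \<forall>e\<in>E. kinner N x e = 0}"
  interpret U: hermitian_on N U T
  proof
    show "K.subspace U"
      using subspace by (auto simp: U_def K.subspace_def kinner_add_left kinner_scale_left)
    show "U \<subseteq> Kvecs N" using carrier by (auto simp: U_def)
    show "T x \<in> U" if "x \<in> U" for x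
    proof -
      have "kinner N (T x) e = 0" if e: "e \<in> E" for e
      proof -
        obtain \<mu> where "T e = scaleK (complex_of_real \<mu>) e" using eE e by blast
        then show ?thesis using \<open>x \<in> U\<close> e EV hermitian[of x e]
          by (auto simp: U_def kinner_scale_right)
      qed
      then show ?thesis using that closed by (auto simp: U_def)
    qed
  qed (auto simp: U_def add scale hermitian)
  have "U = {0}"
  proof (rule ccontr)
    assume "U \<noteq> {0}"
    then obtain y \<mu> where y: "y \<in> U" "y \<noteq> 0" "T y = scaleK (complex_of_real \<mu>) y"
      using U.eigenvector_exists by blast
    have "kinner N y y \<noteq> 0" using y kinner_self_eq_0_iff U.carrier by blast
    then have yE: "y \<notin> E" using y by (auto simp: U_def)
    have "Q (insert y E)"
      using E y U.carrier
      by (auto simp: Q_def korthogonal_def U_def intro: kinner_eq_0_commute)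
    from Emax[OF this] show False using yE oE by (simp add: korthogonal_def)
  qed
  have "V \<subseteq> K.span E"
  proof
    fix x assume x: "x \<in> V"
    define w where "w = (\<Sum>e\<in>E. scaleK (kinner N x e / kinner N e e) e)"
    have wS: "w \<in> K.span E"
      unfolding w_def by (intro K.span_sum K.span_scale K.span_base)
    have wV: "w \<in> V" using wS EV subspace by (meson K.span_minimal subsetD)
    have "kinner N (x - w) e = 0" if e: "e \<in> E" for e
    proof -
      have "kinner N e e \<noteq> 0"
        using e oE kinner_self_eq_0_iff by (auto simp: korthogonal_def)
      then show ?thesis
        using kinner_sum_orthogonal[OF oE e] by (simp add: kinner_diff_left w_def)
    qed
    then have "x - w \<in> U" using x wV subspace by (auto simp: U_def K.subspace_diff)
    then have "x = w" using \<open>U = {0}\<close> by simp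
    then show "x \<in> K.span E" using wS by simp
  qed
  then have "K.span E = V" using EV subspace by (meson K.span_minimal subset_antisym)
  then have "eigenbasis E" using E by (simp add: eigenbasis_def Q_def)
  then show ?thesis ..
qed

text \<open>The Rayleigh quotient turns the eigenvalue into a function of the eigenvector, with no
  choice involved.\<close>

definition eigval :: "(nat \<Rightarrow> complex) \<Rightarrow> real" where
  "eigval e = Re (kinner N (T e) e) / Re (kinner N e e)"

lemma eigenbasisD:
  assumes "eigenbasis E"
  shows "finite E" "korthogonal N E" "K.span E = V" "E \<subseteq> V" "K.independent E"
    and "\<And>e. e \<in> E \<Longrightarrow> T e = scaleK (complex_of_real (eigval e)) e"
    and "\<And>e. e \<in> E \<Longrightarrow> 0 < Re (kinner N e e)"
proof -
  show o: "korthogonal N E" and s: "K.span E = V" using assms by (auto simp: eigenbasis_def)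
  show "finite E" using o by (simp add: korthogonal_def)
  show "E \<subseteq> V" using s K.span_superset by blast
  show "K.independent E" using o by (rule korthogonal_independent)
  show pos: "0 < Re (kinner N e e)" if "e \<in> E" for e
    using that o by (auto simp: korthogonal_def intro!: Re_kinner_self_pos)
  show "T e = scaleK (complex_of_real (eigval e)) e" if e: "e \<in> E" for e
  proof -
    obtain \<mu> where m: "T e = scaleK (complex_of_real \<mu>) e"
      using assms e by (auto simp: eigenbasis_def)
    then have "eigval e = \<mu>"
      using pos[OF e] by (simp add: eigval_def kinner_scale_left)
    with m show ?thesis by simp
  qed
qed

lemma T_sum:
  assumes "eigenbasis E" "S \<subseteq> E"
  shows "T (\<Sum>e\<in>S. scaleK (u e) e) = (\<Sum>e\<in>S. scaleK (u e * complex_of_real (eigval e)) e)"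
proof -
  note E = eigenbasisD[OF assms(1)]
  have "T (\<Sum>e\<in>S. scaleK (u e) e) = (\<Sum>e\<in>S. T (scaleK (u e) e))"
    using assms E(4) by (intro sum) (auto intro: K.subspace_scale[OF subspace])
  also have "\<dots> = (\<Sum>e\<in>S. scaleK (u e * complex_of_real (eigval e)) e)"
    using assms E(4,6) by (intro sum.cong) (auto simp: scale subset_iff)
  finally show ?thesis .
qed

text \<open>Orthogonality removes all cross terms, so on a span of eigenvectors the sign of the
  shifted form is governed by the signs of \<open>eigval e - c\<close>.\<close>

lemma form_sum:
  assumes "eigenbasis E" "S \<subseteq> E" "x = (\<Sum>e\<in>S. scaleK (u e) e)"
  shows "Re (kinner N (T x) x) - c * Re (kinner N x x) =
    (\<Sum>e\<in>S. (eigval e - c) * (cmod (u e))\<^sup>2 * Re (kinner N e e))"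
proof -
  note E = eigenbasisD[OF assms(1)]
  have oS: "korthogonal N S" by (rule korthogonal_subset[OF E(2) assms(2)])
  have "kinner N (T x) x = (\<Sum>e\<in>S. of_real (eigval e * (cmod (u e))\<^sup>2 * Re (kinner N e e)))"
    unfolding assms(3) T_sum[OF assms(1,2)] kinner_sum_sum_orthogonal[OF oS]
    by (intro sum.cong refl, subst kinner_self_eq_Re)
       (simp add: complex_norm_square mult_ac del: of_real_power)
  moreover have "kinner N x x = (\<Sum>e\<in>S. of_real ((cmod (u e))\<^sup>2 * Re (kinner N e e)))"
    unfolding assms(3) kinner_sum_sum_orthogonal[OF oS]
    by (intro sum.cong refl, subst kinner_self_eq_Re)
       (simp add: complex_norm_square mult_ac del: of_real_power)
  ultimately show ?thesis
    by (simp add: sum_distrib_left sum_subtractf[symmetric] algebra_simps)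
qed

lemma op_eigenspace_eq_span:
  assumes "eigenbasis E"
  shows "op_eigenspace T V lam = K.span {e \<in> E. eigval e = lam}" (is "_ = K.span ?S")
proof
  note E = eigenbasisD[OF assms]
  have oS: "korthogonal N ?S" by (rule korthogonal_subset[OF E(2)]) auto
  have fS: "finite ?S" using E by simp
  show "K.span ?S \<subseteq> op_eigenspace T V lam"
  proof
    fix x assume x: "x \<in> K.span ?S"
    then obtain u where u: "x = (\<Sum>e\<in>?S. scaleK (u e) e)"
      using K.span_finite[OF fS] by auto
    have "T x = (\<Sum>e\<in>?S. scaleK (u e * complex_of_real (eigval e)) e)"
      unfolding u by (rule T_sum[OF assms]) auto
    also have "\<dots> = scaleK (complex_of_real lam) x"
      unfolding u K.scale_sum_right by (intro sum.cong) (auto simp: mult.commute)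
    finally show "x \<in> op_eigenspace T V lam"
      using x E(3) K.span_mono[of ?S E] by (auto simp: op_eigenspace_def)
  qed
  show "op_eigenspace T V lam \<subseteq> K.span ?S"
  proof
    fix x assume "x \<in> op_eigenspace T V lam"
    then have x: "x \<in> V" "T x = scaleK (complex_of_real lam) x" by (auto simp: op_eigenspace_def)
    then obtain u where u: "x = (\<Sum>e\<in>E. scaleK (u e) e)"
      using E(3) K.span_finite[OF E(1)] by auto
    have "u y = 0" if y: "y \<in> E" "eigval y \<noteq> lam" for y
    proof -
      have "u y * complex_of_real (eigval y) * kinner N y y = kinner N (T x) y"
        unfolding u T_sum[OF assms subset_refl]
        using kinner_sum_orthogonal[OF E(2) y(1)] by simp
      also have "\<dots> = lam * (u y * kinner N y y)"
        unfolding x kinner_scale_left using u kinner_sum_orthogonal[OF E(2) y(1)] by simp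
      finally have "u y * kinner N y y * (complex_of_real (eigval y) - lam) = 0"
        by (simp add: algebra_simps)
      moreover have "kinner N y y \<noteq> 0" using E(7)[OF y(1)] by auto
      ultimately show ?thesis using y by simp
    qed
    then have "x = (\<Sum>e\<in>?S. scaleK (u e) e)"
      unfolding u using E(1) by (intro sum.mono_neutral_right) auto
    then show "x \<in> K.span ?S"
      using K.span_finite[OF fS] by auto
  qed
qed

lemma dim_op_eigenspace:
  assumes "eigenbasis E"
  shows "K.dim (op_eigenspace T V lam) = card {e \<in> E. eigval e = lam}"
proof -
  note E = eigenbasisD[OF assms]
  have "K.independent {e \<in> E. eigval e = lam}"
    using E(5) by (rule K.independent_mono) auto
  then show ?thesis
    unfolding op_eigenspace_eq_span[OF assms] by (rule K.dim_span_eq_card_independent)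
qed

section \<open>Counting eigenvalues with multiplicity\<close>

definition count_ge :: "real \<Rightarrow> nat" where
  "count_ge c = card {e \<in> (SOME E. eigenbasis E). c \<le> eigval e}"

definition count_gt :: "real \<Rightarrow> nat" where
  "count_gt c = card {e \<in> (SOME E. eigenbasis E). c < eigval e}"

lemma eigenbasis_some: "eigenbasis (SOME E. eigenbasis E)"
  using eigenbasis_exists by (rule someI_ex)

lemma count_ge_eq_count_gt_plus_dim:
  "count_ge c = count_gt c + K.dim (op_eigenspace T V c)"
proof -
  let ?E = "SOME E. eigenbasis E"
  have "{e \<in> ?E. c \<le> eigval e} = {e \<in> ?E. c < eigval e} \<union> {e \<in> ?E. eigval e = c}" by auto
  then show ?thesis
    unfolding count_ge_def count_gt_def dim_op_eigenspace[OF eigenbasis_some]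
    using eigenbasisD(1)[OF eigenbasis_some] by (simp add: card_Un_disjoint disjoint_iff)
qed

lemma count_ge_le_count_gt: "c < d \<Longrightarrow> count_ge d \<le> count_gt c"
  unfolding count_ge_def count_gt_def
  using eigenbasisD(1)[OF eigenbasis_some] by (intro card_mono) auto

lemma count_gt_le_count_ge: "count_gt c \<le> count_ge c"
  by (simp add: count_ge_eq_count_gt_plus_dim)

lemma count_ge_gap:
  "\<exists>\<delta>>0. count_ge (c - \<delta>) = count_ge c \<and> count_ge (c + \<delta>) = count_gt c"
proof -
  let ?E = "SOME E. eigenbasis E"
  \<comment> \<open>The element 1 keeps \<open>D\<close> nonempty when \<open>c\<close> is the only
    eigenvalue or there is none; halving the minimum makes the separation strict.\<close>
  define D where "D = insert 1 ((\<lambda>e. \<bar>eigval e - c\<bar>) ` {e \<in> ?E. eigval e \<noteq> c})"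
  define \<delta> where "\<delta> = Min D / 2"
  have fin: "finite D" using eigenbasisD(1)[OF eigenbasis_some] by (auto simp: D_def)
  have "Min D \<in> D" using fin by (intro Min_in) (auto simp: D_def)
  then have pos: "Min D > 0" by (auto simp: D_def)
  have sep: "\<bar>eigval e - c\<bar> > \<delta>" if "e \<in> ?E" "eigval e \<noteq> c" for e
  proof -
    have "Min D \<le> \<bar>eigval e - c\<bar>" using that fin by (intro Min_le) (auto simp: D_def)
    then show ?thesis using pos by (simp add: \<delta>_def)
  qed
  have d0: "\<delta> > 0" using pos by (simp add: \<delta>_def)
  have "{e \<in> ?E. c - \<delta> \<le> eigval e} = {e \<in> ?E. c \<le> eigval e}"
    using sep d0 by force
  moreover have "{e \<in> ?E. c + \<delta> \<le> eigval e} = {e \<in> ?E. c < eigval e}"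
    using sep d0 by force
  ultimately show ?thesis
    using pos by (intro exI[of _ \<delta>]) (simp add: count_ge_def count_gt_def \<delta>_def)
qed

text \<open>This links the count, read off one chosen eigenbasis, to a multiset specified by
  eigenspace dimensions. Agreement is assumed only from \<open>c\<close> on because
  \<open>pos_eigs_list\<close> prescribes positive eigenvalues only.\<close>

lemma count_ge_eq_sum:
  assumes "\<And>lam. c \<le> lam \<Longrightarrow> count M lam = K.dim (op_eigenspace T V lam)"
  shows "count_ge c = size (filter_mset (\<lambda>lam. c \<le> lam) M)"
proof -
  let ?E = "SOME E. eigenbasis E"
  have fin: "finite ?E" using eigenbasisD(1)[OF eigenbasis_some] .
  have "filter_mset (\<lambda>lam. c \<le> lam) M = image_mset eigval (mset_set {e \<in> ?E. c \<le> eigval e})"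
  proof (rule multiset_eqI)
    fix lam
    show "count (filter_mset (\<lambda>lam. c \<le> lam) M) lam =
      count (image_mset eigval (mset_set {e \<in> ?E. c \<le> eigval e})) lam"
    proof (cases "c \<le> lam")
      case True
      then have "{e \<in> ?E. eigval e = lam} = {e \<in> ?E. c \<le> eigval e \<and> lam = eigval e}" by auto
      then show ?thesis
        using True assms fin
        by (simp add: count_image_mset' dim_op_eigenspace[OF eigenbasis_some] sum.If_cases Int_def conj_ac)
    qed (use fin in \<open>auto simp: count_image_mset'\<close>)
  qed
  then show ?thesis by (simp add: count_ge_def)
qed

end

text \<open>If the count for \<open>T\<close> were larger, the span of the eigenvectors of \<open>T\<close> above \<open>c\<close> would
  meet the span of those of \<open>S\<close> below \<open>d\<close>, by counting dimensions, and the two forms would have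
  opposite signs on the intersection.\<close>
lemma count_ge_mono:
  assumes "hermitian_on N V T" "hermitian_on N V S"
    and le: "\<And>x. x \<in> V \<Longrightarrow> Re (kinner N (T x) x) - c * Re (kinner N x x)
          \<le> Re (kinner N (S x) x) - d * Re (kinner N x x)"
  shows "hermitian_on.count_ge N V T c \<le> hermitian_on.count_ge N V S d"
proof -
  interpret T: hermitian_on N V T by fact
  interpret S: hermitian_on N V S by fact
  define E where "E = (SOME E. T.eigenbasis E)"
  define F where "F = (SOME E. S.eigenbasis E)"
  have ebE: "T.eigenbasis E" and ebF: "S.eigenbasis F"
    using T.eigenbasis_some S.eigenbasis_some by (auto simp: E_def F_def)
  note E = T.eigenbasisD[OF ebE] and F = S.eigenbasisD[OF ebF]
  define A where "A = {e \<in> E. c \<le> T.eigval e}"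
  define B where "B = {e \<in> F. S.eigval e < d}"
  define G where "G = {e \<in> F. d \<le> S.eigval e}"
  have fin: "finite A" "finite B" "finite G" using E F by (auto simp: A_def B_def G_def)
  have indA: "K.independent A" by (rule K.independent_mono[OF E(5)]) (auto simp: A_def)
  have FBG: "F = B \<union> G" "B \<inter> G = {}" by (auto simp: B_def G_def)
  \<comment> \<open>A vector in both spans has only zero coefficients; this one fact yields the
    disjointness of \<open>A\<close> and \<open>B\<close> and the independence of their
    union.\<close>
  have key: "(\<forall>y\<in>A. u y = 0) \<and> (\<forall>y\<in>B. w y = 0)"
    if eq: "(\<Sum>e\<in>A. scaleK (u e) e) = (\<Sum>e\<in>B. scaleK (w e) e)" for u w
  proof -
    define x where "x = (\<Sum>e\<in>A. scaleK (u e) e)"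
    have xB: "x = (\<Sum>e\<in>B. scaleK (w e) e)" using eq x_def by simp
    have "A \<subseteq> V" using E(4) by (auto simp: A_def)
    then have xV: "x \<in> V"
      unfolding x_def by (auto intro!: K.subspace_sum[OF T.subspace] K.subspace_scale[OF T.subspace])
    have fT: "Re (kinner N (T x) x) - c * Re (kinner N x x) =
        (\<Sum>e\<in>A. (T.eigval e - c) * (cmod (u e))\<^sup>2 * Re (kinner N e e))"
      by (rule T.form_sum[OF ebE _ x_def]) (auto simp: A_def)
    have fS: "Re (kinner N (S x) x) - d * Re (kinner N x x) =
        (\<Sum>e\<in>B. (S.eigval e - d) * (cmod (w e))\<^sup>2 * Re (kinner N e e))"
      by (rule S.form_sum[OF ebF _ xB]) (auto simp: B_def)
    have "0 \<le> (\<Sum>e\<in>A. (T.eigval e - c) * (cmod (u e))\<^sup>2 * Re (kinner N e e))"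
      by (intro sum_nonneg mult_nonneg_nonneg) (auto simp: A_def Re_kinner_self_nonneg)
    then have "0 \<le> (\<Sum>e\<in>B. (S.eigval e - d) * (cmod (w e))\<^sup>2 * Re (kinner N e e))"
      using le[OF xV] fT fS by linarith
    then have "(\<Sum>e\<in>B. (d - S.eigval e) * (cmod (w e))\<^sup>2 * Re (kinner N e e)) \<le> 0"
      by (simp add: sum_negf[symmetric] algebra_simps sum_subtractf)
    moreover have nn: "0 \<le> (d - S.eigval e) * (cmod (w e))\<^sup>2 * Re (kinner N e e)" if "e \<in> B" for e
      using that by (intro mult_nonneg_nonneg) (auto simp: B_def Re_kinner_self_nonneg)
    ultimately have eq0: "(\<Sum>e\<in>B. (d - S.eigval e) * (cmod (w e))\<^sup>2 * Re (kinner N e e)) = 0"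
      by (meson order_antisym sum_nonneg)
    have z: "(d - S.eigval e) * (cmod (w e))\<^sup>2 * Re (kinner N e e) = 0" if "e \<in> B" for e
      by (rule sum_nonneg_0[OF fin(2) _ eq0 that]) (rule nn)
    have w0: "w e = 0" if "e \<in> B" for e
      using z[OF that] that F(7)[of e] by (auto simp: B_def)
    then have "(\<Sum>e\<in>A. scaleK (u e) e) = 0" using xB x_def by simp
    then have "\<forall>y\<in>A. u y = 0" using indA K.dependent_finite[OF fin(1)] by blast
    then show ?thesis using w0 by blast
  qed
  \<comment> \<open>\<open>A\<close> and \<open>B\<close> come from different bases and might share
    a vector, so this must be excluded before cardinalities are added. The coefficients singling out
    \<open>y\<close> bring a shared vector into the form of \<open>key\<close>.\<close>
  have disj: "A \<inter> B = {}"
  proof (rule ccontr)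
    assume "A \<inter> B \<noteq> {}"
    then obtain y where y: "y \<in> A" "y \<in> B" by blast
    define u :: "(nat \<Rightarrow> complex) \<Rightarrow> complex" where "u e = (if e = y then 1 else 0)" for e
    have "(\<Sum>e\<in>C. scaleK (u e) e) = y" if "y \<in> C" "finite C" for C
    proof -
      have "(\<Sum>e\<in>C. scaleK (u e) e) = (\<Sum>e\<in>C. if e = y then y else 0)"
        by (intro sum.cong) (auto simp: u_def)
      then show ?thesis using that by simp
    qed
    then have "(\<Sum>e\<in>A. scaleK (u e) e) = (\<Sum>e\<in>B. scaleK (u e) e)" using y fin by simp
    from key[OF this] have "u y = 0" using y by blast
    then show False by (simp add: u_def)
  qed
  have "K.independent (A \<union> B)"
  proof (rule K.independent_if_scalars_zero)
    fix f x assume s: "(\<Sum>x\<in>A \<union> B. scaleK (f x) x) = 0" and x: "x \<in> A \<union> B"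
    have "(\<Sum>e\<in>A. scaleK (f e) e) + (\<Sum>e\<in>B. scaleK (f e) e) = 0"
      using s sum.union_disjoint[OF fin(1,2) disj] by metis
    then have "(\<Sum>e\<in>A. scaleK (f e) e) = (\<Sum>e\<in>B. scaleK (- f e) e)"
      by (simp add: sum_negf add_eq_0_iff2)
    from key[OF this] show "f x = 0" using x by auto
  qed (use fin in auto)
  moreover have "A \<union> B \<subseteq> K.span F" using E(4) F(3,4) by (auto simp: A_def B_def)
  ultimately have "card (A \<union> B) \<le> card F" using K.independent_span_bound[OF F(1)] by blast
  moreover have "card F = card B + card G" using FBG fin by (simp add: card_Un_disjoint)
  moreover have "card (A \<union> B) = card A + card B" using disj fin by (simp add: card_Un_disjoint)
  ultimately show ?thesis
    unfolding T.count_ge_def S.count_ge_def A_def G_def E_def F_def by linarith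
qed

section \<open>Boundary conditions\<close>

lemma mv_in_Kvecs: "mv N A x \<in> Kvecs N"
  by (simp add: mv_def Kvecs_def)

lemma mv_add: "mv N A (x + y) = mv N A x + mv N A y"
  by (auto simp: mv_def fun_eq_iff fun_apply algebra_simps sum.distrib)

lemma mv_scale: "mv N A (scaleK c x) = scaleK c (mv N A x)"
  by (auto simp: mv_def scaleK_def fun_eq_iff sum_distrib_left algebra_simps)

lemma mv_diff: "mv N A (x - y) = mv N A x - mv N A y"
  by (auto simp: mv_def fun_eq_iff algebra_simps sum_subtractf)

lemma mv_zero: "mv N A 0 = 0"
  by (auto simp: mv_def fun_eq_iff fun_apply)

lemma kinner_mv_left: "kinner N (mv N A x) y = kinner N x (mv N (madj A) y)"
proof -
  have "kinner N (mv N A x) y = (\<Sum>i<N. \<Sum>j<N. A i j * x j * cnj (y i))"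
    by (simp add: kinner_def mv_def sum_distrib_right)
  also have "\<dots> = (\<Sum>j<N. \<Sum>i<N. A i j * x j * cnj (y i))"
    by (rule sum.swap)
  also have "\<dots> = kinner N x (mv N (madj A) y)"
    by (simp add: kinner_def mv_def madj_def sum_distrib_left mult_ac)
  finally show ?thesis .
qed

lemma kinner_mv_madj_left: "kinner N (mv N (madj A) x) y = kinner N x (mv N A y)"
  by (metis kinner_commute kinner_mv_left)

lemma kinner_all_zero:
  assumes "x \<in> Kvecs N" "\<And>y. y \<in> Kvecs N \<Longrightarrow> kinner N x y = 0" shows "x = 0"
  using assms kinner_self_eq_0_iff by blast

locale selfadjoint_bc =
  fixes N :: nat and A B :: "nat \<Rightarrow> nat \<Rightarrow> complex"
  assumes surj: "\<forall>y \<in> Kvecs N. \<exists>u \<in> Kvecs N. \<exists>v \<in> Kvecs N. mv N A u + mv N B v = y"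
    and selfadj: "\<forall>i < N. \<forall>j < N.
        (\<Sum>l < N. A i l * cnj (B j l)) = cnj (\<Sum>l < N. A j l * cnj (B i l))"
begin

abbreviation "V \<equiv> RanPperp N B"
abbreviation "P \<equiv> Pperp N B"
abbreviation "L \<equiv> Lop N A B"

section \<open>The projection onto Ran B* and the operator L\<close>

lemma V_subspace: "K.subspace V"
proof -
  have "mv N (madj B) 0 \<in> V" "\<And>y. y \<in> Kvecs N \<Longrightarrow> mv N (madj B) y \<in> V"
    using K.subspace_0[OF subspace_Kvecs] by (auto simp: RanPperp_def)
  then show ?thesis
    unfolding K.subspace_def
    using K.subspace_add[OF subspace_Kvecs] K.subspace_scale[OF subspace_Kvecs]
    by (auto simp: RanPperp_def mv_zero simp flip: mv_add mv_scale)
qed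

lemma V_carrier: "V \<subseteq> Kvecs N"
  by (auto simp: RanPperp_def mv_in_Kvecs)

lemma P_ex1: "\<exists>!w. w \<in> V \<and> (\<forall>u\<in>V. kinner N (x - w) u = 0)"
proof -
  \<comment> \<open>For the zero operator every vector is an eigenvector, so an eigenbasis is simply
    an orthogonal basis of \<open>V\<close>.\<close>
  interpret Z: hermitian_on N V "\<lambda>_. 0"
    by unfold_locales (auto simp: V_subspace V_carrier K.subspace_0[OF V_subspace])
  obtain E where E: "Z.eigenbasis E" using Z.eigenbasis_exists by blast
  note E = Z.eigenbasisD[OF E]
  define w where "w = (\<Sum>e\<in>E. scaleK (kinner N x e / kinner N e e) e)"
  have wV: "w \<in> V"
    unfolding w_def using E(4) by (intro K.subspace_sum[OF V_subspace] K.subspace_scale[OF V_subspace]) auto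
  have e0: "kinner N (x - w) e = 0" if e: "e \<in> E" for e
    using kinner_sum_orthogonal[OF E(2) e] E(7)[OF e] by (auto simp: kinner_diff_left w_def)
  have orth: "kinner N (x - w) u = 0" if u: "u \<in> V" for u
  proof -
    obtain c where "u = (\<Sum>e\<in>E. scaleK (c e) e)"
      using u E(3) K.span_finite[OF E(1)] by auto
    then show ?thesis by (simp add: kinner_sum_right kinner_scale_right e0)
  qed
  show ?thesis
  proof (rule ex1I[of _ w])
    fix w' assume w': "w' \<in> V \<and> (\<forall>u\<in>V. kinner N (x - w') u = 0)"
    have dV: "w' - w \<in> V" using w' wV K.subspace_diff[OF V_subspace] by blast
    have "kinner N (x - w) (w' - w) = 0" "kinner N (x - w') (w' - w) = 0" using dV orth w' by auto
    then have "kinner N (w' - w) (w' - w) = 0" by (simp add: kinner_diff_left)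
    then have "w' - w = 0" using dV V_carrier kinner_self_eq_0_iff by blast
    then show "w' = w" by simp
  qed (use wV orth in blast)
qed

lemma P_in_V: "P x \<in> V" and P_orth: "u \<in> V \<Longrightarrow> kinner N (x - P x) u = 0"
  using theI'[OF P_ex1[of x]] by (auto simp: Pperp_def)

lemma P_eqI: "w \<in> V \<Longrightarrow> (\<And>u. u \<in> V \<Longrightarrow> kinner N (x - w) u = 0) \<Longrightarrow> P x = w"
  using P_ex1[of x] P_in_V[of x] P_orth[of _ x] by blast

lemma kinner_P_left: "u \<in> V \<Longrightarrow> kinner N (P x) u = kinner N x u"
  using P_orth[of u x] by (simp add: kinner_diff_left)

lemma kinner_P_right: "u \<in> V \<Longrightarrow> kinner N u (P x) = kinner N u x"
  by (metis kinner_P_left kinner_commute)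

lemma P_ident: "x \<in> V \<Longrightarrow> P x = x"
  by (rule P_eqI) auto

lemma P_add: "P (x + y) = P x + P y"
  by (rule P_eqI)
     (auto simp: P_in_V K.subspace_add[OF V_subspace] kinner_diff_left kinner_add_left kinner_P_left)

lemma P_scale: "P (scaleK c x) = scaleK c (P x)"
  by (rule P_eqI)
     (auto simp: P_in_V K.subspace_scale[OF V_subspace] kinner_diff_left kinner_scale_left kinner_P_left)

text \<open>\<open>x - P x\<close> is orthogonal to Ran B*, so it lies in Ker B.\<close>

lemma mv_B_P: "mv N B (P x) = mv N B x"
proof -
  have "mv N B (x - P x) = 0"
  proof (rule kinner_all_zero)
    fix y assume "y \<in> Kvecs N"
    then have "mv N (madj B) y \<in> V" by (auto simp: RanPperp_def)
    then show "kinner N (mv N B (x - P x)) y = 0" by (simp only: kinner_mv_left P_orth)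
  qed (rule mv_in_Kvecs)
  then show ?thesis by (simp add: mv_diff)
qed

text \<open>A difference of the form B* w that is killed by B is orthogonal to itself. This gives
  uniqueness in the definite description of \<open>Lop\<close>.\<close>

lemma mv_B_inj_on_V:
  assumes "y \<in> V" "y' \<in> V" "mv N B y = mv N B y'" shows "y = y'"
proof -
  have d: "y - y' \<in> V" using assms K.subspace_diff[OF V_subspace] by blast
  then obtain w where w: "y - y' = mv N (madj B) w" by (auto simp: RanPperp_def)
  have "kinner N (y - y') (y - y') = kinner N (mv N B (y - y')) w"
    by (subst (2) w) (simp add: kinner_mv_left)
  also have "mv N B (y - y') = 0" using assms by (simp add: mv_diff)
  finally have "kinner N (y - y') (y - y') = 0" by (simp only: kinner_zero)
  then have "y - y' = 0" using d V_carrier kinner_self_eq_0_iff by blast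
  then show ?thesis by simp
qed

lemma mv_A_adj_B: "mv N A (mv N (madj B) v) = mv N B (mv N (madj A) v)"
proof
  fix i
  show "mv N A (mv N (madj B) v) i = mv N B (mv N (madj A) v) i"
  proof (cases "i < N")
    case True
    have "mv N A (mv N (madj B) v) i = (\<Sum>l<N. \<Sum>j<N. A i l * cnj (B j l) * v j)"
      using True by (simp add: mv_def madj_def sum_distrib_left mult_ac)
    also have "\<dots> = (\<Sum>j<N. (\<Sum>l<N. A i l * cnj (B j l)) * v j)"
      by (subst sum.swap) (simp add: sum_distrib_right)
    also have "\<dots> = (\<Sum>j<N. (\<Sum>l<N. B i l * cnj (A j l)) * v j)"
      using selfadj True by (intro sum.cong refl) (auto simp: mult.commute)
    also have "\<dots> = (\<Sum>l<N. \<Sum>j<N. B i l * cnj (A j l) * v j)"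
      by (subst sum.swap) (simp add: sum_distrib_right)
    also have "\<dots> = mv N B (mv N (madj A) v) i"
      using True by (simp add: mv_def madj_def sum_distrib_left mult_ac)
    finally show ?thesis .
  qed (simp add: mv_def)
qed

lemma L_eqI:
  assumes "x \<in> V" "y \<in> V" "mv N B y = mv N A x" shows "L x = y"
  unfolding Lop_def
  by (rule the_equality) (use assms mv_B_inj_on_V in \<open>auto simp: P_ident\<close>)

text \<open>B P A* v = B A* v = A B* v, so the projected vector solves the defining equation. As
  every element of \<open>V\<close> is some B* v, this gives existence in \<open>Lop\<close> without
  inverting B.\<close>

lemma L_adj_B: "v \<in> Kvecs N \<Longrightarrow> L (mv N (madj B) v) = P (mv N (madj A) v)"
  by (rule L_eqI) (auto simp: RanPperp_def[of N B] mv_A_adj_B mv_B_P P_in_V[unfolded RanPperp_def])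

lemma L_in_V: assumes "x \<in> V" shows "L x \<in> V"
  using assms L_adj_B P_in_V unfolding RanPperp_def[of N B] by auto

lemma mv_B_L: assumes "x \<in> V" shows "mv N B (L x) = mv N A x"
proof -
  obtain v where "v \<in> Kvecs N" "x = mv N (madj B) v" using assms by (auto simp: RanPperp_def)
  then show ?thesis by (simp add: L_adj_B mv_B_P mv_A_adj_B)
qed

lemma L_add: "x \<in> V \<Longrightarrow> y \<in> V \<Longrightarrow> L (x + y) = L x + L y"
  by (rule L_eqI) (auto simp: K.subspace_add[OF V_subspace] L_in_V mv_add mv_B_L)

lemma L_scale: "x \<in> V \<Longrightarrow> L (scaleK c x) = scaleK c (L x)"
  by (rule L_eqI) (auto simp: K.subspace_scale[OF V_subspace] L_in_V mv_scale mv_B_L)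

text \<open>With x = B* u and y = B* v both sides equal <u, A B* v>, again by A B* = B A*.\<close>

lemma L_hermitian: assumes x: "x \<in> V" and y: "y \<in> V" shows "kinner N (L x) y = kinner N x (L y)"
proof -
  obtain u where u: "u \<in> Kvecs N" "x = mv N (madj B) u" using x by (auto simp: RanPperp_def)
  obtain v where v: "v \<in> Kvecs N" "y = mv N (madj B) v" using y by (auto simp: RanPperp_def)
  have "kinner N (L x) y = kinner N (mv N (madj A) u) (mv N (madj B) v)"
    using y u v by (simp add: L_adj_B kinner_P_left)
  also have "\<dots> = kinner N u (mv N A (mv N (madj B) v))" by (rule kinner_mv_madj_left)
  also have "\<dots> = kinner N (mv N (madj B) u) (mv N (madj A) v)"
    by (simp add: mv_A_adj_B kinner_mv_madj_left)
  also have "\<dots> = kinner N x (L y)" using x u v by (simp add: L_adj_B kinner_P_right)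
  finally show ?thesis .
qed

text \<open>The common shape of L(0,a), R(0,a) and \<open>L(\<kappa>)\<close>, so that Hermiticity
  is proved once for all three.\<close>

definition compressed_sum :: "((nat \<Rightarrow> complex) \<Rightarrow> nat \<Rightarrow> complex) \<Rightarrow> (nat \<Rightarrow> complex) \<Rightarrow> nat \<Rightarrow> complex" where
  "compressed_sum M x = L x + P (M (P x))"

lemma kinner_compressed_sum:
  assumes "x \<in> V" "y \<in> V"
  shows "kinner N (compressed_sum M x) y = kinner N (L x) y + kinner N (M x) y"
  using assms by (simp add: compressed_sum_def P_ident kinner_add_left kinner_P_left)

lemma hermitian_on_compressed_sum:
  assumes "\<And>x y. M (x + y) = M x + M y" "\<And>c x. M (scaleK c x) = scaleK c (M x)"
    and "\<And>x y. kinner N (M x) y = kinner N x (M y)"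
  shows "hermitian_on N V (compressed_sum M)"
proof
  fix x y assume xy: "x \<in> V" "y \<in> V"
  show "kinner N (compressed_sum M x) y = kinner N x (compressed_sum M y)"
    using xy by (simp add: compressed_sum_def P_ident kinner_add_left kinner_add_right
        kinner_P_left kinner_P_right L_hermitian assms)
qed (auto simp: compressed_sum_def V_subspace V_carrier[THEN subsetD] L_in_V P_in_V
      K.subspace_add[OF V_subspace] P_add P_scale L_add L_scale assms K.scale_right_distrib)

section \<open>The boundary condition as an equation for L\<close>

lemma adj_joint_kernel:
  assumes "v \<in> Kvecs N" "mv N (madj A) v = 0" "mv N (madj B) v = 0" shows "v = 0"
proof -
  \<comment> \<open>Surjectivity writes \<open>v\<close> itself as A x + B y; pairing with
    \<open>v\<close> then moves A and B onto \<open>v\<close> as adjoints.\<close>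
  obtain x y where "mv N A x + mv N B y = v" using surj assms(1) by blast
  then have "kinner N v v = kinner N (mv N A x) v + kinner N (mv N B y) v"
    by (metis kinner_add_left)
  also have "\<dots> = 0" by (simp add: kinner_mv_left assms)
  finally show ?thesis using assms(1) kinner_self_eq_0_iff by blast
qed

text \<open>\<open>AB\<^sup>*\<close> being self-adjoint, \<open>(A \<plusminus> \<i>B)(A \<plusminus> \<i>B)\<^sup>* = AA\<^sup>* + BB\<^sup>*\<close>.\<close>
lemma cayley_kernel:
  assumes v: "v \<in> Kvecs N" and c: "c * c = -1"
    and 0: "mv N A (mv N (madj A) v + scaleK c (mv N (madj B) v)) =
      scaleK c (mv N B (mv N (madj A) v + scaleK c (mv N (madj B) v)))"
  shows "v = 0"
proof -
  let ?Y = "scaleK c (mv N B (mv N (madj A) v))"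
  have "?Y + mv N A (mv N (madj A) v) = ?Y + - mv N B (mv N (madj B) v)"
    using 0 by (simp add: mv_add mv_scale mv_A_adj_B K.scale_right_distrib c add.commute)
  then have "mv N A (mv N (madj A) v) = - mv N B (mv N (madj B) v)"
    by (rule add_left_imp_eq)
  then have "mv N A (mv N (madj A) v) + mv N B (mv N (madj B) v) = 0"
    by (simp only: add.left_inverse)
  then have "kinner N (mv N A (mv N (madj A) v)) v + kinner N (mv N B (mv N (madj B) v)) v = 0"
    by (metis kinner_add_left kinner_zero(1))
  then have z: "kinner N (mv N (madj A) v) (mv N (madj A) v) + kinner N (mv N (madj B) v) (mv N (madj B) v) = 0"
    by (simp add: kinner_mv_left)
  have "Re (kinner N (mv N (madj A) v) (mv N (madj A) v)) + Re (kinner N (mv N (madj B) v) (mv N (madj B) v)) = 0"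
    using arg_cong[OF z, of Re] by simp
  then have "mv N (madj A) v = 0" "mv N (madj B) v = 0"
    using Re_kinner_self_pos[OF mv_in_Kvecs] Re_kinner_self_nonneg
    by (smt (verit, best))+
  then show ?thesis using adj_joint_kernel v by blast
qed

text \<open>If A* + c B* kills v, both sides of the premise of \<open>cayley_kernel\<close> vanish,
  so the map is injective and, by dimension, onto.\<close>

lemma cayley_surj:
  assumes c: "c * c = -1" and y: "y \<in> Kvecs N"
  shows "\<exists>v\<in>Kvecs N. mv N (madj A) v + scaleK c (mv N (madj B) v) = y"
proof -
  define f where "f v = mv N (madj A) v + scaleK c (mv N (madj B) v)" for v
  have "f ` Kvecs N = Kvecs N"
  proof (rule linear_inj_imp_surj_Kvecs)
    show "Vector_Spaces.linear scaleK scaleK f"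
      by unfold_locales (auto simp: f_def mv_add mv_scale K.scale_right_distrib mult.commute)
    show "f ` Kvecs N \<subseteq> Kvecs N"
      by (auto simp: f_def mv_in_Kvecs K.subspace_add[OF subspace_Kvecs] K.subspace_scale[OF subspace_Kvecs])
    show "x = 0" if "x \<in> Kvecs N" "f x = 0" for x
      using cayley_kernel[OF that(1) c] that(2) by (simp add: f_def mv_zero)
  qed
  then show ?thesis using y unfolding f_def by (metis (no_types, lifting) imageE)
qed

text \<open>The pairs (B* v, -A* v) satisfy the boundary condition since A B* = B A*; the point is
  that they exhaust it. Choose v so that the remainder (p, q) of (x, y) has q = ip. Then (A + iB) p
  = 0, while p = (A + iB)* u for some u, so \<open>cayley_kernel\<close> forces u = 0 and p = q =
  0.\<close>

lemma bc_imp_adj: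
  assumes x: "x \<in> Kvecs N" and y: "y \<in> Kvecs N" and 0: "mv N A x + mv N B y = 0"
  shows "\<exists>v\<in>Kvecs N. x = mv N (madj B) v \<and> y = scaleK (-1) (mv N (madj A) v)"
proof -
  have "scaleK \<i> x - y \<in> Kvecs N"
    using x y by (simp add: K.subspace_diff[OF subspace_Kvecs] K.subspace_scale[OF subspace_Kvecs])
  then obtain v where v: "v \<in> Kvecs N"
    and veq: "mv N (madj A) v + scaleK \<i> (mv N (madj B) v) = scaleK \<i> x - y"
    using cayley_surj[of \<i>] by auto
  define p where "p = x - mv N (madj B) v"
  define q where "q = y + mv N (madj A) v"
  have qp: "q = scaleK \<i> p"
  proof
    fix i show "q i = scaleK \<i> p i"
      using fun_cong[OF veq, of i] by (simp add: p_def q_def fun_apply scaleK_def algebra_simps)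
  qed
  have "mv N A p + mv N B q = mv N A x + mv N B y"
    by (simp add: p_def q_def mv_diff mv_add mv_A_adj_B)
  then have pq: "mv N A p + scaleK \<i> (mv N B p) = 0" using 0 qp by (simp add: mv_scale)
  have pK: "p \<in> Kvecs N" using x by (simp add: p_def mv_in_Kvecs K.subspace_diff[OF subspace_Kvecs])
  obtain u where u: "u \<in> Kvecs N" "mv N (madj A) u + scaleK (-\<i>) (mv N (madj B) u) = p"
    using cayley_surj[of "-\<i>", OF _ pK] by auto
  have "u = 0"
    by (rule cayley_kernel[of _ "-\<i>"]) (use u pq in \<open>auto simp: eq_neg_iff_add_eq_0\<close>)
  then have "p = 0" using u by (simp add: mv_zero)
  then have "q = 0" using qp by simp
  then show ?thesis using v \<open>p = 0\<close>
    by (intro bexI[of _ v]) (auto simp: p_def q_def add_eq_0_iff2)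
qed

text \<open>The parametrisation of \<open>bc_imp_adj\<close> forces x into Ran B* and identifies
  both terms. Conversely, applying B to L x + P y = 0 restores the condition, as B L = A on
  \<open>V\<close> and B P = B.\<close>

lemma bc_iff:
  assumes x: "x \<in> Kvecs N" and y: "y \<in> Kvecs N"
  shows "mv N A x + mv N B y = 0 \<longleftrightarrow> x \<in> V \<and> L x + P y = 0"
proof
  assume "mv N A x + mv N B y = 0"
  from bc_imp_adj[OF x y this] obtain v where v: "v \<in> Kvecs N" "x = mv N (madj B) v"
    "y = scaleK (-1) (mv N (madj A) v)" by blast
  have "L x = P (mv N (madj A) v)" using v by (simp add: L_adj_B)
  moreover have "P y = - P (mv N (madj A) v)"
    unfolding v(3) P_scale by (simp only: K.scale_minus_left K.scale_one)
  ultimately have "L x + P y = 0" by (simp only: add.right_inverse)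
  then show "x \<in> V \<and> L x + P y = 0" using v by (auto simp: RanPperp_def[of N B])
next
  assume a: "x \<in> V \<and> L x + P y = 0"
  then have "mv N B (L x) + mv N B (P y) = 0" by (metis mv_add mv_zero)
  then show "mv N A x + mv N B y = 0" using a by (simp add: mv_B_L mv_B_P)
qed

end

subsection \<open>Vertex matrices diagonal in even and odd combinations\<close>

text \<open>On internal edge \<open>q\<close> the matrix has eigenvalue \<open>s q\<close> on vectors with equal, and \<open>t q\<close>
  on vectors with opposite, entries at the two endpoints.\<close>
definition even_odd_mat :: "nat \<Rightarrow> nat \<Rightarrow> real \<Rightarrow> (nat \<Rightarrow> real) \<Rightarrow> (nat \<Rightarrow> real) \<Rightarrow> (nat \<Rightarrow> complex) \<Rightarrow> nat \<Rightarrow> complex" where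
  "even_odd_mat m k e s t x = (\<lambda>i.
     if i < m then of_real e * x i
     else if i < m + k then (of_real (s (i - m)) * (x i + x (i + k)) + of_real (t (i - m)) * (x i - x (i + k))) / 2
     else if i < m + 2 * k then
       (of_real (s (i - m - k)) * (x (i - k) + x i) + of_real (t (i - m - k)) * (x i - x (i - k))) / 2
     else 0)"

lemma even_odd_mat_add: "even_odd_mat m k e s t (x + y) = even_odd_mat m k e s t x + even_odd_mat m k e s t y"
  by (auto simp: even_odd_mat_def fun_eq_iff fun_apply field_simps)

lemma even_odd_mat_scale: "even_odd_mat m k e s t (scaleK c x) = scaleK c (even_odd_mat m k e s t x)"
  by (auto simp: even_odd_mat_def fun_eq_iff scaleK_def field_simps)

lemma even_odd_mat_in_Kvecs: "even_odd_mat m k e s t x \<in> Kvecs (Kdim m k)"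
  by (auto simp: even_odd_mat_def Kvecs_def Kdim_def)

lemma sum_lessThan_add: "(\<Sum>i<(a::nat)+b. f i) = (\<Sum>i<a. f i) + (\<Sum>i<b. f (a + i))"
  for f :: "nat \<Rightarrow> 'a::comm_monoid_add"
  by (induction b) (auto simp: add.assoc)

text \<open>The two endpoint coordinates \<open>m + q\<close> and \<open>m + k + q\<close> of an
  edge are summed together. Passing to their sum and difference doubles the inner product, hence the
  factors 1/2.\<close>

lemma kinner_even_odd_mat:
  "kinner (Kdim m k) (even_odd_mat m k e s t x) y =
     (\<Sum>i<m. of_real e * (x i * cnj (y i))) +
     (\<Sum>q<k. of_real (s q) / 2 * ((x (m + q) + x (m + k + q)) * cnj (y (m + q) + y (m + k + q))) +
        of_real (t q) / 2 * ((x (m + q) - x (m + k + q)) * cnj (y (m + q) - y (m + k + q))))"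
proof -
  let ?M = "even_odd_mat m k e s t x"
  have "kinner (Kdim m k) ?M y = (\<Sum>i<m. ?M i * cnj (y i)) +
     (\<Sum>q<k. ?M (m + q) * cnj (y (m + q)) + ?M (m + k + q) * cnj (y (m + k + q)))"
    unfolding kinner_def Kdim_def
    using sum_lessThan_add[of "\<lambda>i. ?M i * cnj (y i)" "m + k" k]
      sum_lessThan_add[of "\<lambda>i. ?M i * cnj (y i)" m k]
    by (simp add: sum.distrib mult_2 add.assoc)
  also have "(\<Sum>i<m. ?M i * cnj (y i)) = (\<Sum>i<m. of_real e * (x i * cnj (y i)))"
    by (intro sum.cong) (auto simp: even_odd_mat_def)
  also have "(\<Sum>q<k. ?M (m + q) * cnj (y (m + q)) + ?M (m + k + q) * cnj (y (m + k + q))) =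
    (\<Sum>q<k. of_real (s q) / 2 * ((x (m + q) + x (m + k + q)) * cnj (y (m + q) + y (m + k + q))) +
        of_real (t q) / 2 * ((x (m + q) - x (m + k + q)) * cnj (y (m + q) - y (m + k + q))))"
  proof (intro sum.cong refl)
    fix q assume "q \<in> {..<k}"
    then have 1: "?M (m + q) = (of_real (s q) * (x (m + q) + x (m + k + q)) + of_real (t q) * (x (m + q) - x (m + k + q))) / 2"
      by (simp add: even_odd_mat_def add.assoc add.commute[of q k])
    have 2: "m + k + q - m - k = q" "m + k + q - k = m + q" by auto
    have 3: "?M (m + k + q) = (of_real (s q) * (x (m + q) + x (m + k + q)) + of_real (t q) * (x (m + k + q) - x (m + q))) / 2"
      using \<open>q \<in> {..<k}\<close> unfolding even_odd_mat_def 2 by simp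
    show "?M (m + q) * cnj (y (m + q)) + ?M (m + k + q) * cnj (y (m + k + q)) =
      of_real (s q) / 2 * ((x (m + q) + x (m + k + q)) * cnj (y (m + q) + y (m + k + q))) +
        of_real (t q) / 2 * ((x (m + q) - x (m + k + q)) * cnj (y (m + q) - y (m + k + q)))"
      unfolding 1 3 by (simp add: field_simps)
  qed
  finally show ?thesis .
qed

lemma even_odd_mat_hermitian:
  "kinner (Kdim m k) (even_odd_mat m k e s t x) y = kinner (Kdim m k) x (even_odd_mat m k e s t y)"
  by (subst (2) kinner_commute) (simp add: kinner_even_odd_mat mult_ac)

lemma Re_kinner_even_odd_mat:
  "Re (kinner (Kdim m k) (even_odd_mat m k e s t x) x) =
     (\<Sum>i<m. e * (cmod (x i))\<^sup>2) +
     (\<Sum>q<k. s q / 2 * (cmod (x (m + q) + x (m + k + q)))\<^sup>2 +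
        t q / 2 * (cmod (x (m + q) - x (m + k + q)))\<^sup>2)"
proof -
  have "kinner (Kdim m k) (even_odd_mat m k e s t x) x = of_real (
     (\<Sum>i<m. e * (cmod (x i))\<^sup>2) +
     (\<Sum>q<k. s q / 2 * (cmod (x (m + q) + x (m + k + q)))\<^sup>2 +
        t q / 2 * (cmod (x (m + q) - x (m + k + q)))\<^sup>2))"
    unfolding kinner_even_odd_mat of_real_add of_real_sum of_real_mult complex_norm_square by simp
  then show ?thesis by simp
qed

lemma kinner_self_even_odd:
  "Re (kinner (Kdim m k) x x) = (\<Sum>i<m. (cmod (x i))\<^sup>2) +
     (\<Sum>q<k. (cmod (x (m + q) + x (m + k + q)))\<^sup>2 / 2 + (cmod (x (m + q) - x (m + k + q)))\<^sup>2 / 2)"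
proof -
  have "kinner (Kdim m k) x x = kinner (Kdim m k) (even_odd_mat m k 1 (\<lambda>_. 1) (\<lambda>_. 1) x) x"
    unfolding kinner_def by (intro sum.cong) (auto simp: even_odd_mat_def Kdim_def)
  then show ?thesis using Re_kinner_even_odd_mat[of m k 1 "\<lambda>_. 1" "\<lambda>_. 1" x] by simp
qed

text \<open>Sums and differences diagonalise all these matrices and the identity at once, so the
  form inequality follows from scalar ones.\<close>

lemma even_odd_mat_form_le:
  assumes "e - c \<le> e' - d" "\<And>q. q < k \<Longrightarrow> s q - c \<le> s' q - d" "\<And>q. q < k \<Longrightarrow> t q - c \<le> t' q - d"
  shows "Re (kinner (Kdim m k) (even_odd_mat m k e s t x) x) - c * Re (kinner (Kdim m k) x x) \<le>
    Re (kinner (Kdim m k) (even_odd_mat m k e' s' t' x) x) - d * Re (kinner (Kdim m k) x x)"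
proof -
  have eq: "Re (kinner (Kdim m k) (even_odd_mat m k e s t x) x) - c * Re (kinner (Kdim m k) x x) =
     (\<Sum>i<m. (e - c) * (cmod (x i))\<^sup>2) +
     (\<Sum>q<k. (s q - c) * ((cmod (x (m + q) + x (m + k + q)))\<^sup>2 / 2) +
        (t q - c) * ((cmod (x (m + q) - x (m + k + q)))\<^sup>2 / 2))" for e s t c
    unfolding Re_kinner_even_odd_mat kinner_self_even_odd
    by (simp add: algebra_simps sum.distrib sum_subtractf sum_distrib_left
        diff_divide_distrib add_divide_distrib)
  show ?thesis unfolding eq
    by (intro add_mono sum_mono mult_right_mono) (use assms in auto)
qed

section \<open>Eigenfunctions for negative eigenvalues\<close>

definition even_coeff :: "real \<Rightarrow> real \<Rightarrow> real" where
  "even_coeff \<kappa> l = - \<kappa> * ((exp (\<kappa> * l) - 1) / (exp (\<kappa> * l) + 1))"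

definition odd_coeff :: "real \<Rightarrow> real \<Rightarrow> real" where
  "odd_coeff \<kappa> l = - \<kappa> * ((exp (\<kappa> * l) + 1) / (exp (\<kappa> * l) - 1))"

text \<open>The Dirichlet-to-Neumann matrix \<open>M(\<i>\<kappa>, a)\<close>; the coefficients above are
  \<open>-\<kappa> tanh (\<kappa>l/2)\<close> and \<open>-\<kappa> coth (\<kappa>l/2)\<close>.\<close>
definition DtN :: "nat \<Rightarrow> nat \<Rightarrow> (nat \<Rightarrow> real) \<Rightarrow> real \<Rightarrow> (nat \<Rightarrow> complex) \<Rightarrow> nat \<Rightarrow> complex" where
  "DtN m k a \<kappa> = even_odd_mat m k (- \<kappa>) (\<lambda>q. even_coeff \<kappa> (a q)) (\<lambda>q. odd_coeff \<kappa> (a q))"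

text \<open>With E the exponential of \<kappa>l, x + x' = (E + 1)(p + r/E) and x - x' = (E - 1)(r/E
  - p), which cancels the denominators of the coefficients. The left sides are the derivatives at
  the two ends, each taken into the edge.\<close>

lemma exp_edge_boundary:
  fixes p r :: complex
  assumes "\<kappa> * l > 0"
    and x: "x = p + r" and x': "x' = exp (\<kappa> * l) *\<^sub>R p + exp (- (\<kappa> * l)) *\<^sub>R r"
  shows "of_real \<kappa> * (p - r) =
      (of_real (even_coeff \<kappa> l) * (x + x') + of_real (odd_coeff \<kappa> l) * (x - x')) / 2"
    and "- (of_real \<kappa> * (exp (\<kappa> * l) *\<^sub>R p - exp (- (\<kappa> * l)) *\<^sub>R r)) =
      (of_real (even_coeff \<kappa> l) * (x + x') + of_real (odd_coeff \<kappa> l) * (x' - x)) / 2"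
proof -
  define E where "E = complex_of_real (exp (\<kappa> * l))"
  have E1: "exp (\<kappa> * l) > 1" using assms(1) by simp
  have "Re E > 1" using E1 by (simp add: E_def)
  then have ne: "E \<noteq> 0" "E + 1 \<noteq> 0" "E - 1 \<noteq> 0" "E \<noteq> 1"
    by (auto simp: complex_eq_iff)
  have x'E: "x' = E * p + r / E"
    unfolding x' by (simp add: E_def scaleR_conv_of_real exp_minus divide_simps)
  have ev: "of_real (even_coeff \<kappa> l) = - of_real \<kappa> * ((E - 1) / (E + 1))"
    and od: "of_real (odd_coeff \<kappa> l) = - of_real \<kappa> * ((E + 1) / (E - 1))"
    by (auto simp: even_coeff_def odd_coeff_def E_def simp del: of_real_exp)
  have "x + x' = (E + 1) * (p + r / E)" and d: "x - x' = (E - 1) * (r / E - p)"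
    using ne by (auto simp: x x'E field_simps)
  then have 1: "of_real (even_coeff \<kappa> l) * (x + x') = - of_real \<kappa> * (E - 1) * (p + r / E)"
    unfolding ev using ne by simp
  have 2: "of_real (odd_coeff \<kappa> l) * (x - x') = - of_real \<kappa> * (E + 1) * (r / E - p)"
    unfolding od d using ne by simp
  have 3: "of_real (odd_coeff \<kappa> l) * (x' - x) = of_real \<kappa> * (E + 1) * (r / E - p)"
    using 2 by (simp add: algebra_simps)
  show "of_real \<kappa> * (p - r) =
      (of_real (even_coeff \<kappa> l) * (x + x') + of_real (odd_coeff \<kappa> l) * (x - x')) / 2"
    unfolding 1 2 using ne(1) by (simp add: field_simps)
  have 4: "exp (\<kappa> * l) *\<^sub>R p = E * p" "exp (- (\<kappa> * l)) *\<^sub>R r = r / E"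
    by (simp_all add: E_def scaleR_conv_of_real exp_minus divide_simps)
  show "- (of_real \<kappa> * (exp (\<kappa> * l) *\<^sub>R p - exp (- (\<kappa> * l)) *\<^sub>R r)) =
      (of_real (even_coeff \<kappa> l) * (x + x') + of_real (odd_coeff \<kappa> l) * (x' - x)) / 2"
    unfolding 1 3 4 using ne(1) by (simp add: field_simps)
qed

section \<open>The differential equation on a single edge\<close>

lemma linear_ode_solution:
  fixes g :: "real \<Rightarrow> complex"
  assumes "\<And>t. t \<in> {0..b} \<Longrightarrow> (g has_vector_derivative c *\<^sub>R g t) (at t within {0..b})"
    and t: "t \<in> {0..b}"
  shows "g t = exp (c * t) *\<^sub>R g 0"
proof -
  have "((\<lambda>t. exp (- (c * t)) *\<^sub>R g t) has_vector_derivative 0) (at t within {0..b})"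
    if "t \<in> {0..b}" for t
  proof -
    have "((\<lambda>t. exp (- (c * t))) has_real_derivative - c * exp (- (c * t))) (at t within {0..b})"
      by (auto intro!: derivative_eq_intros)
    from has_vector_derivative_scaleR[OF this assms(1)[OF that]]
    show ?thesis by (simp add: algebra_simps)
  qed
  then obtain K where K: "\<And>t. t \<in> {0..b} \<Longrightarrow> exp (- (c * t)) *\<^sub>R g t = K"
    using has_vector_derivative_zero_constant[of "{0..b}" "\<lambda>t. exp (- (c * t)) *\<^sub>R g t"] by auto
  have "exp (- (c * t)) *\<^sub>R g t = g 0" using K[OF t] K[of 0] t by simp
  then have "exp (c * t) *\<^sub>R exp (- (c * t)) *\<^sub>R g t = exp (c * t) *\<^sub>R g 0" by simp
  then show ?thesis by (simp flip: exp_add)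
qed

lemma edge_solution:
  fixes f f1 f2 :: "real \<Rightarrow> complex"
  assumes \<kappa>: "\<kappa> > 0"
    and I2: "\<And>t. t \<in> {0..b} \<Longrightarrow> (f2 has_integral f1 t - f1 0) {0..t}"
    and I1: "\<And>t. t \<in> {0..b} \<Longrightarrow> (f1 has_integral f t - f 0) {0..t}"
    and ae: "AE x in lborel. x \<in> {0..b} \<longrightarrow> f2 x = of_real (\<kappa>\<^sup>2) * f x"
    and p: "p = (f1 0 + of_real \<kappa> * f 0) / of_real (2 * \<kappa>)"
    and r: "r = (of_real \<kappa> * f 0 - f1 0) / of_real (2 * \<kappa>)"
    and t: "t \<in> {0..b}"
  shows "f t = exp (\<kappa> * t) *\<^sub>R p + exp (- (\<kappa> * t)) *\<^sub>R r"
    and "f1 t = of_real \<kappa> * (exp (\<kappa> * t) *\<^sub>R p - exp (- (\<kappa> * t)) *\<^sub>R r)"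
proof -
  have b: "0 \<le> b" "b \<in> {0..b}" using t by auto
  have eq1: "f1 t = f1 0 + integral {0..t} f2" and eq: "f t = f 0 + integral {0..t} f1"
    if "t \<in> {0..b}" for t
    using I1[OF that] I2[OF that] by (auto simp: has_integral_iff)
  have "continuous_on {0..b} (\<lambda>t. f1 0 + integral {0..t} f2)"
    using I2[OF b(2)] by (intro continuous_intros indefinite_integral_continuous_1) (auto simp: has_integral_iff)
  then have cont1: "continuous_on {0..b} f1"
    by (rule continuous_on_eq) (rule eq1[symmetric])
  have "continuous_on {0..b} (\<lambda>t. f 0 + integral {0..t} f1)"
    using I1[OF b(2)] by (intro continuous_intros indefinite_integral_continuous_1) (auto simp: has_integral_iff)
  then have cont: "continuous_on {0..b} f"
    by (rule continuous_on_eq) (rule eq[symmetric])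
  have d: "(f has_vector_derivative f1 t) (at t within {0..b})" if "t \<in> {0..b}" for t
  proof -
    have "((\<lambda>t. f 0 + integral {0..t} f1) has_vector_derivative 0 + f1 t) (at t within {0..b})"
      by (intro has_vector_derivative_add integral_has_vector_derivative cont1 that) auto
    then have "((\<lambda>t. f 0 + integral {0..t} f1) has_vector_derivative f1 t) (at t within {0..b})"
      by simp
    then show ?thesis by (rule has_vector_derivative_transform[OF that eq, rotated])
  qed
  \<comment> \<open>\<open>f2\<close> is known only almost everywhere. Under the integral it may be
    replaced by the continuous multiple of \<open>f\<close>, which makes \<open>f1\<close>
    differentiable at every point.\<close>
  have eq2: "f1 t = f1 0 + integral {0..t} (\<lambda>x. of_real (\<kappa>\<^sup>2) * f x)" if "t \<in> {0..b}" for t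
  proof -
    have "AE x in lborel. x \<in> {0..t} \<longrightarrow> f2 x = of_real (\<kappa>\<^sup>2) * f x"
      using ae by eventually_elim (use that in auto)
    from has_integral_AE[OF this] have "((\<lambda>x. of_real (\<kappa>\<^sup>2) * f x) has_integral f1 t - f1 0) {0..t}"
      using I2[OF that] by blast
    then show ?thesis by (auto simp: has_integral_iff)
  qed
  have d1: "(f1 has_vector_derivative of_real (\<kappa>\<^sup>2) * f t) (at t within {0..b})" if "t \<in> {0..b}" for t
  proof -
    have "((\<lambda>t. f1 0 + integral {0..t} (\<lambda>x. of_real (\<kappa>\<^sup>2) * f x)) has_vector_derivative
       0 + of_real (\<kappa>\<^sup>2) * f t) (at t within {0..b})"
      by (intro has_vector_derivative_add integral_has_vector_derivative continuous_intros cont that) auto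
    then have "((\<lambda>t. f1 0 + integral {0..t} (\<lambda>x. of_real (\<kappa>\<^sup>2) * f x)) has_vector_derivative
       of_real (\<kappa>\<^sup>2) * f t) (at t within {0..b})"
      by simp
    then show ?thesis by (rule has_vector_derivative_transform[OF that eq2, rotated])
  qed
  \<comment> \<open>The second-order equation factors: \<open>f1 + \<kappa> f\<close> and
    \<open>f1 - \<kappa> f\<close> solve first-order equations with rates \<kappa> and
    -\<kappa>.\<close>
  have u: "f1 t + of_real \<kappa> * f t = exp (\<kappa> * t) *\<^sub>R (f1 0 + of_real \<kappa> * f 0)"
    by (rule linear_ode_solution[OF _ t])
       (auto intro!: derivative_eq_intros d d1 simp: scaleR_conv_of_real algebra_simps power2_eq_square)
  have w: "f1 t - of_real \<kappa> * f t = exp (- \<kappa> * t) *\<^sub>R (f1 0 - of_real \<kappa> * f 0)"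
    by (rule linear_ode_solution[OF _ t])
       (auto intro!: derivative_eq_intros d d1 simp: scaleR_conv_of_real algebra_simps power2_eq_square)
  have k0: "complex_of_real \<kappa> \<noteq> 0" using \<kappa> by simp
  have P: "f1 0 + of_real \<kappa> * f 0 = 2 * of_real \<kappa> * p" and R: "f1 0 - of_real \<kappa> * f 0 = - 2 * of_real \<kappa> * r"
    using k0 by (auto simp: p r field_simps)
  define Ep where "Ep = complex_of_real (exp (\<kappa> * t))"
  define Em where "Em = complex_of_real (exp (- (\<kappa> * t)))"
  have u': "f1 t + of_real \<kappa> * f t = 2 * of_real \<kappa> * (Ep * p)"
    and w': "f1 t - of_real \<kappa> * f t = - (2 * of_real \<kappa> * (Em * r))"
    using u w unfolding P R by (auto simp: Ep_def Em_def scaleR_conv_of_real)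
  have "2 * of_real \<kappa> * f t = 2 * of_real \<kappa> * (Ep * p + Em * r)"
    using arg_cong2[OF u' w', of "(-)"] by (simp add: algebra_simps)
  then show "f t = exp (\<kappa> * t) *\<^sub>R p + exp (- (\<kappa> * t)) *\<^sub>R r"
    using k0 by (simp add: Ep_def Em_def scaleR_conv_of_real)
  have "2 * f1 t = 2 * (of_real \<kappa> * (Ep * p - Em * r))"
    using arg_cong2[OF u' w', of "(+)"] by (simp add: algebra_simps)
  then show "f1 t = of_real \<kappa> * (exp (\<kappa> * t) *\<^sub>R p - exp (- (\<kappa> * t)) *\<^sub>R r)"
    by (simp add: Ep_def Em_def scaleR_conv_of_real)
qed

text \<open>The squared modulus of p is at most that of the growing term, hence at most the
  integrable function \<open>g\<close>; a positive constant has no integrable majorant on a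
  half-line.\<close>

lemma L2_half_line_no_growth:
  assumes \<kappa>: "\<kappa> > 0" and L2: "L2_on f {0..}"
    and f: "\<And>t. t \<ge> 0 \<Longrightarrow> f t = exp (\<kappa> * t) *\<^sub>R p + exp (- (\<kappa> * t)) *\<^sub>R r"
  shows "p = 0"
proof (rule ccontr)
  assume "p \<noteq> 0"
  define g where "g t = 2 * (cmod (f t))\<^sup>2 + 2 * (cmod r)\<^sup>2 * exp (- (2 * \<kappa>) * t)" for t
  have "(\<lambda>t. (cmod (f t))\<^sup>2) integrable_on {0..}"
    using L2 by (intro integrable_on_lebesgue_on) (auto simp: L2_on_def)
  moreover have "(\<lambda>t. exp (- (2 * \<kappa>) * t)) integrable_on {0..}"
    using \<kappa> by (intro integrable_on_exp_minus_to_infinity) auto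
  ultimately have gi: "g integrable_on {0..}"
    unfolding g_def by (intro integrable_add integrable_on_mult_right)
  have g0: "0 \<le> g t" for t by (simp add: g_def)
  have lower: "(cmod p)\<^sup>2 \<le> g t" if "t \<ge> 0" for t
  proof -
    have "cmod p \<le> exp (\<kappa> * t) * cmod p"
      using mult_right_mono[of 1 "exp (\<kappa> * t)" "cmod p"] \<kappa> that by simp
    also have "\<dots> = cmod (f t - exp (- (\<kappa> * t)) *\<^sub>R r)" using f[OF that] by simp
    also have "\<dots> \<le> cmod (f t) + exp (- (\<kappa> * t)) * cmod r"
      using norm_triangle_ineq4[of "f t" "exp (- (\<kappa> * t)) *\<^sub>R r"] by simp
    finally have "(cmod p)\<^sup>2 \<le> (cmod (f t) + exp (- (\<kappa> * t)) * cmod r)\<^sup>2"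
      by (intro power_mono) auto
    also have "\<dots> \<le> 2 * (cmod (f t))\<^sup>2 + 2 * (exp (- (\<kappa> * t)) * cmod r)\<^sup>2"
      using sum_squares_bound[of "cmod (f t)" "exp (- (\<kappa> * t)) * cmod r"]
      by (simp add: power2_sum)
    also have "(exp (- (\<kappa> * t)) * cmod r)\<^sup>2 = (cmod r)\<^sup>2 * exp (- (2 * \<kappa>) * t)"
      by (simp add: power_mult_distrib flip: exp_double)
    finally show ?thesis by (simp add: g_def)
  qed
  \<comment> \<open>On an interval of this length the constant integrates to one more than the whole
    integral of \<open>g\<close>.\<close>
  define b where "b = (integral {0..} g + 1) / (cmod p)\<^sup>2"
  have I0: "0 \<le> integral {0..} g" using g0 gi by (simp add: integral_nonneg)
  have b: "b \<ge> 0" using I0 by (simp add: b_def)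
  have gib: "g integrable_on {0..b}"
    using gi by (rule integrable_on_subinterval) auto
  have "integral {0..b} (\<lambda>_. (cmod p)\<^sup>2) \<le> integral {0..b} g"
    using lower gib by (intro integral_le) auto
  also have "\<dots> \<le> integral {0..} g"
    using gib gi g0 by (intro integral_subset_le) auto
  finally have "b * (cmod p)\<^sup>2 \<le> integral {0..} g" using b by simp
  moreover have "b * (cmod p)\<^sup>2 = integral {0..} g + 1" using \<open>p \<noteq> 0\<close> by (simp add: b_def)
  ultimately show False by simp
qed

lemma L2_on_cong: "(\<And>t. t \<in> S \<Longrightarrow> f t = g t) \<Longrightarrow> S \<in> sets lebesgue \<Longrightarrow> L2_on f S \<longleftrightarrow> L2_on g S"
  unfolding L2_on_def
  by (intro conj_cong measurable_cong Bochner_Integration.integrable_cong) auto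

lemma L2_on_continuous_interval:
  assumes "continuous_on {0..b} f" shows "L2_on f {0..b::real}"
  unfolding L2_on_def using assms
  by (auto intro!: continuous_imp_measurable_on_sets_lebesgue continuous_imp_integrable_real continuous_intros)

lemma L2_on_decaying_exp:
  assumes "\<kappa> > 0" shows "L2_on (\<lambda>t. exp (- (\<kappa> * t)) *\<^sub>R r) {0..}"
proof -
  have "(\<lambda>t. exp (- (2 * \<kappa>) * t)) integrable_on {0..}"
    using assms by (intro integrable_on_exp_minus_to_infinity) auto
  then have "(\<lambda>t. exp (- (2 * \<kappa>) * t)) absolutely_integrable_on {0..}"
    by (intro nonnegative_absolutely_integrable_1) auto
  then have "integrable (lebesgue_on {0..}) (\<lambda>t. exp (- (2 * \<kappa>) * t))"
    by (intro absolutely_integrable_imp_integrable) auto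
  then have "integrable (lebesgue_on {0..}) (\<lambda>t. exp (- (2 * \<kappa>) * t) * (cmod r)\<^sup>2)"
    by (rule integrable_mult_left)
  moreover have "(cmod (exp (- (\<kappa> * t)) *\<^sub>R r))\<^sup>2 = exp (- (2 * \<kappa>) * t) * (cmod r)\<^sup>2" for t
    by (simp add: power_mult_distrib flip: exp_double)
  ultimately show ?thesis
    unfolding L2_on_def
    by (auto intro!: continuous_imp_measurable_on_sets_lebesgue continuous_intros)
qed

text \<open>The coefficients come from solving \<open>p + r = x\<^sub>j\<close>, \<open>p e\<^sup>\<kappa>\<^sup>l + r e\<^sup>-\<^sup>\<kappa>\<^sup>l = x\<^sub>j\<^sub>+\<^sub>k\<close> on an internal
  edge of length \<open>l\<close>.\<close>
definition sol_p :: "nat \<Rightarrow> nat \<Rightarrow> (nat \<Rightarrow> real) \<Rightarrow> real \<Rightarrow> (nat \<Rightarrow> complex) \<Rightarrow> nat \<Rightarrow> complex" where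
  "sol_p m k a \<kappa> x j = (if j < m then 0
     else (x (j + k) - exp (- (\<kappa> * a (j - m))) *\<^sub>R x j) /
       of_real (exp (\<kappa> * a (j - m)) - exp (- (\<kappa> * a (j - m)))))"

definition sol_r :: "nat \<Rightarrow> nat \<Rightarrow> (nat \<Rightarrow> real) \<Rightarrow> real \<Rightarrow> (nat \<Rightarrow> complex) \<Rightarrow> nat \<Rightarrow> complex" where
  "sol_r m k a \<kappa> x j = (if j < m then x j
     else (exp (\<kappa> * a (j - m)) *\<^sub>R x j - x (j + k)) /
       of_real (exp (\<kappa> * a (j - m)) - exp (- (\<kappa> * a (j - m)))))"

definition sol :: "nat \<Rightarrow> nat \<Rightarrow> (nat \<Rightarrow> real) \<Rightarrow> real \<Rightarrow> (nat \<Rightarrow> complex) \<Rightarrow> nat \<Rightarrow> real \<Rightarrow> complex" where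
  "sol m k a \<kappa> x = (\<lambda>j t. if j < m + k \<and> t \<in> edge_int m a j
     then exp (\<kappa> * t) *\<^sub>R sol_p m k a \<kappa> x j + exp (- (\<kappa> * t)) *\<^sub>R sol_r m k a \<kappa> x j else 0)"

lemma linear_sol: "Vector_Spaces.linear scaleK scaleH (sol m k a \<kappa>)"
proof -
  have "sol_p m k a \<kappa> (x + y) j = sol_p m k a \<kappa> x j + sol_p m k a \<kappa> y j"
    "sol_r m k a \<kappa> (x + y) j = sol_r m k a \<kappa> x j + sol_r m k a \<kappa> y j"
    "sol_p m k a \<kappa> (scaleK c x) j = c * sol_p m k a \<kappa> x j"
    "sol_r m k a \<kappa> (scaleK c x) j = c * sol_r m k a \<kappa> x j" for x y j c
    by (auto simp: sol_p_def sol_r_def fun_apply scaleK_def scaleR_conv_of_real algebra_simps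
        add_divide_distrib diff_divide_distrib)
  then show ?thesis
    by unfold_locales
      (auto simp: sol_def fun_eq_iff fun_apply scaleH_def scaleR_conv_of_real algebra_simps)
qed

text \<open>Up to sign, E - F is the determinant of the two endpoint equations, equal to 2
  sinh(\<kappa>l) and nonzero as \<kappa>l > 0.\<close>

lemma sol_coeffs:
  assumes "\<kappa> * a q > 0"
  shows "sol_p m k a \<kappa> x (m + q) + sol_r m k a \<kappa> x (m + q) = x (m + q)"
    and "exp (\<kappa> * a q) *\<^sub>R sol_p m k a \<kappa> x (m + q) + exp (- (\<kappa> * a q)) *\<^sub>R sol_r m k a \<kappa> x (m + q)
      = x (m + k + q)"
proof -
  define E where "E = complex_of_real (exp (\<kappa> * a q))"
  define F where "F = complex_of_real (exp (- (\<kappa> * a q)))"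
  have ne: "E - F \<noteq> 0"
    using assms(1) unfolding E_def F_def of_real_diff[symmetric] of_real_eq_0_iff by auto
  have p: "sol_p m k a \<kappa> x (m + q) = (x (m + k + q) - F * x (m + q)) / (E - F)"
    and r: "sol_r m k a \<kappa> x (m + q) = (E * x (m + q) - x (m + k + q)) / (E - F)"
    by (simp_all add: sol_p_def sol_r_def E_def F_def scaleR_conv_of_real add_ac)
  show "sol_p m k a \<kappa> x (m + q) + sol_r m k a \<kappa> x (m + q) = x (m + q)"
    unfolding p r add_divide_distrib[symmetric] using ne by (simp add: divide_eq_eq algebra_simps)
  have "E * ((x (m + k + q) - F * x (m + q)) / (E - F)) + F * ((E * x (m + q) - x (m + k + q)) / (E - F))
    = x (m + k + q)"
    unfolding times_divide_eq_right add_divide_distrib[symmetric] using ne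
    by (simp add: divide_eq_eq algebra_simps)
  then show "exp (\<kappa> * a q) *\<^sub>R sol_p m k a \<kappa> x (m + q) + exp (- (\<kappa> * a q)) *\<^sub>R sol_r m k a \<kappa> x (m + q)
      = x (m + k + q)"
    unfolding p r by (simp add: E_def F_def scaleR_conv_of_real)
qed

lemma sol_coeffs_unique:
  assumes "\<kappa> * a q > 0"
    and x: "x (m + q) = p + r" "x (m + k + q) = exp (\<kappa> * a q) *\<^sub>R p + exp (- (\<kappa> * a q)) *\<^sub>R r"
  shows "sol_p m k a \<kappa> x (m + q) = p" "sol_r m k a \<kappa> x (m + q) = r"
proof -
  define E where "E = complex_of_real (exp (\<kappa> * a q))"
  define F where "F = complex_of_real (exp (- (\<kappa> * a q)))"
  have ne: "E - F \<noteq> 0"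
    using assms(1) unfolding E_def F_def of_real_diff[symmetric] of_real_eq_0_iff by auto
  have "sol_p m k a \<kappa> x (m + q) = (x (m + k + q) - F * x (m + q)) / (E - F)"
    and "sol_r m k a \<kappa> x (m + q) = (E * x (m + q) - x (m + k + q)) / (E - F)"
    by (simp_all add: sol_p_def sol_r_def E_def F_def scaleR_conv_of_real add_ac)
  moreover have "x (m + k + q) = E * p + F * r" using x by (simp add: E_def F_def scaleR_conv_of_real)
  ultimately show "sol_p m k a \<kappa> x (m + q) = p" "sol_r m k a \<kappa> x (m + q) = r"
    using ne x(1) by (simp_all add: divide_eq_eq algebra_simps)
qed

lemma bval_in_Kvecs: "bval m k a psi \<in> Kvecs (Kdim m k)"
  and bder_in_Kvecs: "bder m k a psi1 \<in> Kvecs (Kdim m k)"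
  by (auto simp: bval_def bder_def Kvecs_def Kdim_def)

lemma Kindex_cases:
  assumes "i < Kdim m k"
  obtains "i < m" | q where "q < k" "i = m + q" | q where "q < k" "i = m + k + q"
proof -
  consider "i < m" | "m \<le> i" "i < m + k" | "m + k \<le> i" by linarith
  then show ?thesis
  proof cases
    case 2 then show ?thesis using that(2)[of "i - m"] by auto
  next
    case 3 then show ?thesis using that(3)[of "i - m - k"] assms by (auto simp: Kdim_def)
  qed (use that(1) in blast)
qed

lemma Kvecs_eqI:
  assumes "x \<in> Kvecs (Kdim m k)" "y \<in> Kvecs (Kdim m k)"
    and "\<And>i. i < m \<Longrightarrow> x i = y i"
    and "\<And>q. q < k \<Longrightarrow> x (m + q) = y (m + q)"
    and "\<And>q. q < k \<Longrightarrow> x (m + k + q) = y (m + k + q)"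
  shows "x = y"
proof
  fix i
  show "x i = y i"
  proof (cases "i < Kdim m k")
    case True
    then show ?thesis by (cases rule: Kindex_cases) (use assms in auto)
  qed (use assms(1,2) in \<open>auto simp: Kvecs_def\<close>)
qed

lemma bval_simps:
  "i < m \<Longrightarrow> bval m k a psi i = psi i 0"
  "q < k \<Longrightarrow> bval m k a psi (m + q) = psi (m + q) 0"
  "q < k \<Longrightarrow> bval m k a psi (m + k + q) = psi (m + q) (a q)"
proof -
  have eq: "m + k + q - k = m + q" "m + k + q - m - k = q" by auto
  show "q < k \<Longrightarrow> bval m k a psi (m + k + q) = psi (m + q) (a q)"
    unfolding bval_def eq by simp
qed (simp_all add: bval_def)

lemma bder_simps:
  "i < m \<Longrightarrow> bder m k a psi i = psi i 0"
  "q < k \<Longrightarrow> bder m k a psi (m + q) = psi (m + q) 0"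
  "q < k \<Longrightarrow> bder m k a psi (m + k + q) = - psi (m + q) (a q)"
proof -
  have eq: "m + k + q - k = m + q" "m + k + q - m - k = q" by auto
  show "q < k \<Longrightarrow> bder m k a psi (m + k + q) = - psi (m + q) (a q)"
    unfolding bder_def eq by simp
qed (simp_all add: bder_def)

lemma DtN_simps:
  "i < m \<Longrightarrow> DtN m k a \<kappa> x i = - of_real \<kappa> * x i"
  "q < k \<Longrightarrow> DtN m k a \<kappa> x (m + q) =
     (of_real (even_coeff \<kappa> (a q)) * (x (m + q) + x (m + k + q)) +
      of_real (odd_coeff \<kappa> (a q)) * (x (m + q) - x (m + k + q))) / 2"
  "q < k \<Longrightarrow> DtN m k a \<kappa> x (m + k + q) =
     (of_real (even_coeff \<kappa> (a q)) * (x (m + q) + x (m + k + q)) +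
      of_real (odd_coeff \<kappa> (a q)) * (x (m + k + q) - x (m + q))) / 2"
proof -
  have eq: "m + k + q - m - k = q" "m + k + q - k = m + q" "m + q + k = m + k + q" by auto
  show "q < k \<Longrightarrow> DtN m k a \<kappa> x (m + k + q) =
     (of_real (even_coeff \<kappa> (a q)) * (x (m + q) + x (m + k + q)) +
      of_real (odd_coeff \<kappa> (a q)) * (x (m + k + q) - x (m + q))) / 2"
    unfolding DtN_def even_odd_mat_def eq by simp
  show "q < k \<Longrightarrow> DtN m k a \<kappa> x (m + q) =
     (of_real (even_coeff \<kappa> (a q)) * (x (m + q) + x (m + k + q)) +
      of_real (odd_coeff \<kappa> (a q)) * (x (m + q) - x (m + k + q))) / 2"
    unfolding DtN_def even_odd_mat_def eq by simp
qed (simp add: DtN_def even_odd_mat_def)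

lemma DtN_in_Kvecs: "DtN m k a \<kappa> x \<in> Kvecs (Kdim m k)"
  by (simp add: DtN_def even_odd_mat_in_Kvecs)

lemma edge_int_simps:
  "i < m \<Longrightarrow> edge_int m a i = {0..}" "edge_int m a (m + q) = {0..a q}"
  by (auto simp: edge_int_def)

lemma edge_int_lebesgue: "edge_int m a j \<in> sets lebesgue"
  by (auto simp: edge_int_def)

lemma edge_cases:
  fixes j :: nat
  assumes "j < m + k" obtains "j < m" | q where "q < k" "j = m + q"
  using that(1) that(2)[of "j - m"] assms by fastforce

lemma bval_sol:
  assumes a: "\<forall>q<k. a q > 0" and \<kappa>: "\<kappa> > 0" and x: "x \<in> Kvecs (Kdim m k)"
  shows "bval m k a (sol m k a \<kappa> x) = x"
proof (rule Kvecs_eqI[OF bval_in_Kvecs x])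
  show "bval m k a (sol m k a \<kappa> x) i = x i" if "i < m" for i
    using that by (simp add: bval_simps sol_def edge_int_simps sol_p_def sol_r_def)
next
  fix q assume q: "q < k"
  then have aq: "a q > 0" and ka: "\<kappa> * a q > 0" using a \<kappa> by auto
  show "bval m k a (sol m k a \<kappa> x) (m + q) = x (m + q)"
    using q aq sol_coeffs(1)[of \<kappa> a q, OF ka] by (simp add: bval_simps sol_def edge_int_simps)
  show "bval m k a (sol m k a \<kappa> x) (m + k + q) = x (m + k + q)"
    using q aq sol_coeffs(2)[of \<kappa> a q, OF ka] by (simp add: bval_simps sol_def edge_int_simps)
qed

lemma sol_eigenfunction:
  assumes a: "\<forall>q<k. a q > 0" and \<kappa>: "\<kappa> > 0" and x: "x \<in> Kvecs (Kdim m k)"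
  shows "\<exists>psi1 psi2. in_D m k a (sol m k a \<kappa> x) psi1 psi2 \<and> bder m k a psi1 = DtN m k a \<kappa> x \<and>
     (\<forall>j<m + k. AE t in lebesgue_on (edge_int m a j).
        - psi2 j t = complex_of_real (- \<kappa>\<^sup>2) * sol m k a \<kappa> x j t)"
proof (intro exI conjI)
  let ?p = "sol_p m k a \<kappa> x" and ?r = "sol_r m k a \<kappa> x"
  \<comment> \<open>\<open>sol\<close> is cut off outside the edge; \<open>f\<close> is the same
    formula on the whole line, where it can be differentiated freely.\<close>
  define f where "f j t = exp (\<kappa> * t) *\<^sub>R ?p j + exp (- (\<kappa> * t)) *\<^sub>R ?r j" for j t
  define psi1 where "psi1 j t = of_real \<kappa> * (exp (\<kappa> * t) *\<^sub>R ?p j - exp (- (\<kappa> * t)) *\<^sub>R ?r j)" for j t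
  define psi2 where "psi2 j t = of_real (\<kappa>\<^sup>2) * f j t" for j t
  have sf: "sol m k a \<kappa> x j t = f j t" if "j < m + k" "t \<in> edge_int m a j" for j t
    using that by (simp add: sol_def f_def)
  have d: "(f j has_vector_derivative psi1 j t) (at t within S)"
    and d1: "(psi1 j has_vector_derivative psi2 j t) (at t within S)" for j t S
    unfolding f_def[abs_def] psi1_def[abs_def] psi2_def
    by (auto intro!: derivative_eq_intros simp: scaleR_conv_of_real algebra_simps power2_eq_square)
  have L2f: "L2_on (f j) (edge_int m a j)" if "j < m + k" for j
    using that
  proof (cases rule: edge_cases)
    case 1
    then have "f j = (\<lambda>t. exp (- (\<kappa> * t)) *\<^sub>R ?r j)" by (auto simp: f_def sol_p_def)
    then show ?thesis using 1 L2_on_decaying_exp[OF \<kappa>] by (simp add: edge_int_simps)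
  next
    case (2 q)
    then show ?thesis unfolding f_def[abs_def]
      by (auto simp: edge_int_simps intro!: L2_on_continuous_interval continuous_intros)
  qed
  have L2c: "L2_on (\<lambda>t. c * g t) S" if "L2_on g S" for c g S
    using that by (auto simp: L2_on_def norm_mult power_mult_distrib)
  show "in_D m k a (sol m k a \<kappa> x) psi1 psi2"
    unfolding in_D_def
  proof (intro conjI allI impI ballI)
    show "sol m k a \<kappa> x j t = 0" if "m + k \<le> j \<or> t \<notin> edge_int m a j" for j t
      using that by (auto simp: sol_def)
  next
    fix j assume j: "j < m + k"
    show "L2_on (sol m k a \<kappa> x j) (edge_int m a j)"
      using L2_on_cong[of "edge_int m a j" "sol m k a \<kappa> x j" "f j"] sf[OF j] edge_int_lebesgue L2f[OF j]
      by blast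
    show "L2_on (psi2 j) (edge_int m a j)"
      unfolding psi2_def[abs_def] by (intro L2c L2f j)
    fix t assume t: "t \<in> edge_int m a j"
    then have t0: "t \<ge> 0" and 0: "0 \<in> edge_int m a j" by (auto simp: edge_int_def split: if_splits)
    show "(psi2 j has_integral psi1 j t - psi1 j 0) {0..t}"
      by (intro fundamental_theorem_of_calculus t0 d1)
    show "(psi1 j has_integral sol m k a \<kappa> x j t - sol m k a \<kappa> x j 0) {0..t}"
      unfolding sf[OF j t] sf[OF j 0] by (intro fundamental_theorem_of_calculus t0 d)
  qed
  show "bder m k a psi1 = DtN m k a \<kappa> x"
  proof (rule Kvecs_eqI[OF bder_in_Kvecs DtN_in_Kvecs])
    show "bder m k a psi1 i = DtN m k a \<kappa> x i" if "i < m" for i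
      using that by (simp add: bder_simps DtN_simps psi1_def sol_p_def sol_r_def)
  next
    fix q assume q: "q < k"
    then have ka: "\<kappa> * a q > 0" using a \<kappa> by auto
    note b = exp_edge_boundary[OF ka sol_coeffs(1)[of \<kappa> a q, OF ka, symmetric]
        sol_coeffs(2)[of \<kappa> a q, OF ka, symmetric], of m k x]
    show "bder m k a psi1 (m + q) = DtN m k a \<kappa> x (m + q)"
      using q b(1) by (simp add: bder_simps DtN_simps psi1_def)
    show "bder m k a psi1 (m + k + q) = DtN m k a \<kappa> x (m + k + q)"
      using q b(2) by (simp add: bder_simps DtN_simps psi1_def)
  qed
  show "\<forall>j<m + k. AE t in lebesgue_on (edge_int m a j).
        - psi2 j t = complex_of_real (- \<kappa>\<^sup>2) * sol m k a \<kappa> x j t"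
    by (intro allI impI AE_I2) (auto simp: psi2_def sf)
qed

lemma eigenfunction_is_sol:
  assumes a: "\<forall>q<k. a q > 0" and \<kappa>: "\<kappa> > 0" and D: "in_D m k a psi psi1 psi2"
    and ae: "\<forall>j<m + k. AE t in lebesgue_on (edge_int m a j).
        - psi2 j t = complex_of_real (- \<kappa>\<^sup>2) * psi j t"
  shows "psi = sol m k a \<kappa> (bval m k a psi)" "bder m k a psi1 = DtN m k a \<kappa> (bval m k a psi)"
proof -
  define p where "p j = (psi1 j 0 + of_real \<kappa> * psi j 0) / of_real (2 * \<kappa>)" for j
  define r where "r j = (of_real \<kappa> * psi j 0 - psi1 j 0) / of_real (2 * \<kappa>)" for j
  let ?x = "bval m k a psi"
  have form: "psi j t = exp (\<kappa> * t) *\<^sub>R p j + exp (- (\<kappa> * t)) *\<^sub>R r j"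
    "psi1 j t = of_real \<kappa> * (exp (\<kappa> * t) *\<^sub>R p j - exp (- (\<kappa> * t)) *\<^sub>R r j)"
    if j: "j < m + k" and t: "t \<in> edge_int m a j" for j t
  proof -
    \<comment> \<open>Solving on [0, t] with t as the right end treats half-lines and bounded edges
      alike.\<close>
    have sub: "{0..t} \<subseteq> edge_int m a j" and tt: "t \<in> {0..t}"
      using t by (auto simp: edge_int_def split: if_splits)
    have "AE x in lebesgue. x \<in> edge_int m a j \<longrightarrow> - psi2 j x = complex_of_real (- \<kappa>\<^sup>2) * psi j x"
      using ae j AE_restrict_space_iff[of "edge_int m a j" lebesgue] edge_int_lebesgue by auto
    then have "AE x in lborel. x \<in> edge_int m a j \<longrightarrow> - psi2 j x = complex_of_real (- \<kappa>\<^sup>2) * psi j x"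
      by (simp only: AE_completion_iff)
    then have ae': "AE x in lborel. x \<in> {0..t} \<longrightarrow> psi2 j x = of_real (\<kappa>\<^sup>2) * psi j x"
      by eventually_elim (use sub in auto)
    have I: "(psi2 j has_integral psi1 j s - psi1 j 0) {0..s}"
      "(psi1 j has_integral psi j s - psi j 0) {0..s}" if "s \<in> {0..t}" for s
      using D j that sub unfolding in_D_def by (meson subsetD)+
    show "psi j t = exp (\<kappa> * t) *\<^sub>R p j + exp (- (\<kappa> * t)) *\<^sub>R r j"
      "psi1 j t = of_real \<kappa> * (exp (\<kappa> * t) *\<^sub>R p j - exp (- (\<kappa> * t)) *\<^sub>R r j)"
      using edge_solution[OF \<kappa> I ae' p_def r_def tt] by blast+
  qed
  have 0: "0 \<in> edge_int m a j" if "j < m + k" for j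
    using that a by (cases rule: edge_cases) (auto simp: edge_int_simps less_imp_le)
  have p0: "p j = 0" if "j < m" for j
  proof (rule L2_half_line_no_growth[OF \<kappa>])
    have "L2_on (psi j) (edge_int m a j)" using D that by (simp add: in_D_def)
    then show "L2_on (psi j) {0..}" using that by (simp add: edge_int_simps)
    show "psi j t = exp (\<kappa> * t) *\<^sub>R p j + exp (- (\<kappa> * t)) *\<^sub>R r j" if "t \<ge> 0" for t
      using form(1)[of j t] that \<open>j < m\<close> by (simp add: edge_int_simps)
  qed
  have int: "?x (m + q) = p (m + q) + r (m + q)"
    "?x (m + k + q) = exp (\<kappa> * a q) *\<^sub>R p (m + q) + exp (- (\<kappa> * a q)) *\<^sub>R r (m + q)"
    if "q < k" for q
    using form(1)[of "m + q" 0] form(1)[of "m + q" "a q"] that a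
    by (auto simp: bval_simps edge_int_simps less_imp_le)
  have pr: "sol_p m k a \<kappa> ?x j = p j" "sol_r m k a \<kappa> ?x j = r j" if "j < m + k" for j
    using that
  proof (atomize (full), cases rule: edge_cases)
    case 1
    then show "sol_p m k a \<kappa> ?x j = p j \<and> sol_r m k a \<kappa> ?x j = r j"
      using form(1)[OF that 0[OF that]] p0 by (simp add: sol_p_def sol_r_def bval_simps)
  next
    case (2 q)
    then have ka: "\<kappa> * a q > 0" using a \<kappa> by auto
    show "sol_p m k a \<kappa> ?x j = p j \<and> sol_r m k a \<kappa> ?x j = r j"
      using sol_coeffs_unique[of \<kappa> a q, OF ka int[OF 2(1)]] 2 by simp
  qed
  show "psi = sol m k a \<kappa> ?x"
  proof (intro ext)
    fix j t
    show "psi j t = sol m k a \<kappa> ?x j t"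
    proof (cases "j < m + k \<and> t \<in> edge_int m a j")
      case True then show ?thesis using form(1) pr by (simp add: sol_def)
    next
      case False then show ?thesis using D by (auto simp: sol_def in_D_def)
    qed
  qed
  show "bder m k a psi1 = DtN m k a \<kappa> ?x"
  proof (rule Kvecs_eqI[OF bder_in_Kvecs DtN_in_Kvecs])
    show "bder m k a psi1 i = DtN m k a \<kappa> ?x i" if i: "i < m" for i
      using form[of i 0] 0[of i] p0[OF i] i by (simp add: bder_simps DtN_simps bval_simps)
  next
    fix q assume q: "q < k"
    then have ka: "\<kappa> * a q > 0" and aq: "a q > 0" using a \<kappa> by auto
    note b = exp_edge_boundary[OF ka int[OF q]]
    show "bder m k a psi1 (m + q) = DtN m k a \<kappa> ?x (m + q)"
      using q b(1) form(2)[of "m + q" 0] aq by (simp add: bder_simps DtN_simps edge_int_simps)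
    show "bder m k a psi1 (m + k + q) = DtN m k a \<kappa> ?x (m + k + q)"
      using q b(2) form(2)[of "m + q" "a q"] aq by (simp add: bder_simps DtN_simps edge_int_simps)
  qed
qed

section \<open>Multiplicities of the negative eigenvalues\<close>

lemma dim_linear_inj_image:
  assumes lin: "Vector_Spaces.linear scaleK scaleH f" and S: "K.subspace S" and inj: "inj_on f S"
  shows "H.dim (f ` S) = K.dim S"
proof -
  interpret f: Vector_Spaces.linear scaleK scaleH f by fact
  obtain B where B: "B \<subseteq> S" "K.independent B" "S \<subseteq> K.span B" "card B = K.dim S"
    by (rule K.basis_exists)
  have sp: "K.span B = S" using B S by (meson K.span_minimal subset_antisym)
  have "H.independent (f ` B)"
    by (rule f.independent_injective_image[OF B(2)]) (simp add: sp inj)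
  moreover have "f ` S = H.span (f ` B)" using f.span_image[of B] sp by simp
  ultimately have "H.dim (f ` S) = card (f ` B)" by (metis H.dim_span_eq_card_independent)
  also have "\<dots> = card B" using inj B(1) by (meson card_image inj_on_subset)
  finally show ?thesis using B(4) by simp
qed

locale graph_bc = selfadjoint_bc "Kdim m k" A B for m k :: nat and A B +
  fixes a :: "nat \<Rightarrow> real"
  assumes lengths: "\<forall>q<k. a q > 0"
begin

lemma hermitian_on_even_odd: "hermitian_on (Kdim m k) V (compressed_sum (even_odd_mat m k e s t))"
  by (intro hermitian_on_compressed_sum even_odd_mat_add even_odd_mat_scale even_odd_mat_hermitian)

lemma hermitian_on_DtN: "hermitian_on (Kdim m k) V (compressed_sum (DtN m k a \<kappa>))"
  unfolding DtN_def by (rule hermitian_on_even_odd)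

text \<open>\<open>sol\<close> and \<open>bval\<close> are inverse to each other between
  eigenfunctions and admissible boundary values, and the derivatives become \<open>DtN\<close> of
  these values; \<open>bc_iff\<close> then yields the kernel of \<open>L(\<kappa>)\<close>.\<close>

lemma Delta_eigenspace_eq:
  assumes \<kappa>: "\<kappa> > 0"
  shows "Delta_eigenspace m k a A B (- \<kappa>\<^sup>2) =
    sol m k a \<kappa> ` op_eigenspace (compressed_sum (DtN m k a \<kappa>)) V 0"
proof
  have ker: "x \<in> op_eigenspace (compressed_sum (DtN m k a \<kappa>)) V 0 \<longleftrightarrow>
      mv (Kdim m k) A x + mv (Kdim m k) B (DtN m k a \<kappa> x) = 0" if "x \<in> Kvecs (Kdim m k)" for x
    unfolding bc_iff[OF that DtN_in_Kvecs]
    by (auto simp: op_eigenspace_def compressed_sum_def P_ident)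
  show "Delta_eigenspace m k a A B (- \<kappa>\<^sup>2) \<subseteq> sol m k a \<kappa> ` op_eigenspace (compressed_sum (DtN m k a \<kappa>)) V 0"
  proof
    fix psi assume "psi \<in> Delta_eigenspace m k a A B (- \<kappa>\<^sup>2)"
    then obtain psi1 psi2 where D: "in_D m k a psi psi1 psi2"
      and bc: "mv (Kdim m k) A (bval m k a psi) + mv (Kdim m k) B (bder m k a psi1) = 0"
      and ae: "\<forall>j < m + k. AE x in lebesgue_on (edge_int m a j).
            - psi2 j x = complex_of_real (- \<kappa>\<^sup>2) * psi j x"
      unfolding Delta_eigenspace_def zero_fun_def by blast
    note s = eigenfunction_is_sol[OF lengths \<kappa> D ae]
    have "bval m k a psi \<in> op_eigenspace (compressed_sum (DtN m k a \<kappa>)) V 0"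
      using bc ker[OF bval_in_Kvecs] s(2) by simp
    then show "psi \<in> sol m k a \<kappa> ` op_eigenspace (compressed_sum (DtN m k a \<kappa>)) V 0"
      using s(1) by blast
  qed
  show "sol m k a \<kappa> ` op_eigenspace (compressed_sum (DtN m k a \<kappa>)) V 0 \<subseteq> Delta_eigenspace m k a A B (- \<kappa>\<^sup>2)"
  proof clarify
    fix x assume x: "x \<in> op_eigenspace (compressed_sum (DtN m k a \<kappa>)) V 0"
    then have xK: "x \<in> Kvecs (Kdim m k)" using V_carrier by (auto simp: op_eigenspace_def)
    obtain psi1 psi2 where D: "in_D m k a (sol m k a \<kappa> x) psi1 psi2" "bder m k a psi1 = DtN m k a \<kappa> x"
     "\<forall>j<m + k. AE t in lebesgue_on (edge_int m a j).
        - psi2 j t = complex_of_real (- \<kappa>\<^sup>2) * sol m k a \<kappa> x j t"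
      using sol_eigenfunction[OF lengths \<kappa> xK] by blast
    moreover have "mv (Kdim m k) A (bval m k a (sol m k a \<kappa> x)) + mv (Kdim m k) B (bder m k a psi1) = 0"
      using ker[OF xK] x D(2) bval_sol[OF lengths \<kappa> xK] by simp
    ultimately show "sol m k a \<kappa> x \<in> Delta_eigenspace m k a A B (- \<kappa>\<^sup>2)"
      unfolding Delta_eigenspace_def zero_fun_def by blast
  qed
qed

lemma dim_Delta_eigenspace:
  assumes \<kappa>: "\<kappa> > 0"
  shows "H.dim (Delta_eigenspace m k a A B (- \<kappa>\<^sup>2)) =
    K.dim (op_eigenspace (compressed_sum (DtN m k a \<kappa>)) V 0)"
proof -
  interpret T: hermitian_on "Kdim m k" V "compressed_sum (DtN m k a \<kappa>)" by (rule hermitian_on_DtN)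
  let ?S = "op_eigenspace (compressed_sum (DtN m k a \<kappa>)) V 0"
  obtain E where "T.eigenbasis E" using T.eigenbasis_exists by blast
  then have "K.subspace ?S" unfolding T.op_eigenspace_eq_span[OF \<open>T.eigenbasis E\<close>]
    by (intro K.subspace_span)
  moreover have "inj_on (sol m k a \<kappa>) ?S"
  proof (rule inj_on_inverseI)
    fix x assume "x \<in> ?S"
    then have "x \<in> Kvecs (Kdim m k)" using V_carrier by (auto simp: op_eigenspace_def)
    then show "bval m k a (sol m k a \<kappa> x) = x" by (rule bval_sol[OF lengths \<kappa>])
  qed
  ultimately have "H.dim (sol m k a \<kappa> ` ?S) = K.dim ?S"
    by (rule dim_linear_inj_image[OF linear_sol])
  then show ?thesis by (simp only: Delta_eigenspace_eq[OF \<kappa>])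
qed

end

section \<open>Monotonicity of the Dirichlet-to-Neumann coefficients\<close>

text \<open>The coefficient is -\<kappa> + 2\<kappa>/(E + 1) with E \<ge> 1 + \<kappa>l. The three
  bounds serve the comparisons with M(0,a) - \<kappa>, with M1(a) - \<kappa>, and strictly with
  M(0,a), whose even entry is 0.\<close>

lemma even_coeff_bounds:
  assumes "\<kappa> > 0" "l > 0"
  shows "- \<kappa> \<le> even_coeff \<kappa> l" "even_coeff \<kappa> l \<le> 2 / l - \<kappa>" "even_coeff \<kappa> l < 0"
proof -
  define E where "E = exp (\<kappa> * l)"
  have y: "\<kappa> * l > 0" using assms by simp
  have E1: "E > 1" using y by (simp add: E_def)
  have Ey: "1 + \<kappa> * l \<le> E" unfolding E_def by (rule exp_ge_add_one_self)
  have e: "even_coeff \<kappa> l = - \<kappa> + \<kappa> * (2 / (E + 1))"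
    using E1 by (simp add: even_coeff_def E_def[symmetric] field_simps)
  show "- \<kappa> \<le> even_coeff \<kappa> l" using e E1 assms by simp
  have "\<kappa> * l \<le> E + 1" using Ey by simp
  then have "\<kappa> * (2 / (E + 1)) \<le> 2 / l" using E1 assms by (simp add: field_simps)
  then show "even_coeff \<kappa> l \<le> 2 / l - \<kappa>" using e by simp
  have "0 < \<kappa> * ((E - 1) / (E + 1))" using E1 assms by (intro mult_pos_pos divide_pos_pos) auto
  then show "even_coeff \<kappa> l < 0" by (simp add: even_coeff_def E_def)
qed

text \<open>The coefficient is -\<kappa> - 2\<kappa>/(E - 1), and E - 1 \<ge> \<kappa>l.\<close>

lemma odd_coeff_bounds:
  assumes "\<kappa> > 0" "l > 0"
  shows "- (2 / l) - \<kappa> \<le> odd_coeff \<kappa> l" "odd_coeff \<kappa> l \<le> - \<kappa>"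
proof -
  define E where "E = exp (\<kappa> * l)"
  have y: "\<kappa> * l > 0" using assms by simp
  have E1: "E > 1" using y by (simp add: E_def)
  have Ey: "1 + \<kappa> * l \<le> E" unfolding E_def by (rule exp_ge_add_one_self)
  have e: "odd_coeff \<kappa> l = - \<kappa> - \<kappa> * (2 / (E - 1))"
    using E1 by (simp add: odd_coeff_def E_def[symmetric] field_simps)
  show "odd_coeff \<kappa> l \<le> - \<kappa>" using e E1 assms by simp
  have "\<kappa> * l \<le> E - 1" using Ey by simp
  then have "\<kappa> * (2 / (E - 1)) \<le> 2 / l" using E1 assms by (simp add: field_simps)
  then show "- (2 / l) - \<kappa> \<le> odd_coeff \<kappa> l" using e by simp
qed

lemma even_coeff_strict_antimono:
  assumes "0 < \<kappa>" "\<kappa> < \<kappa>'" "l > 0"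
  shows "even_coeff \<kappa>' l < even_coeff \<kappa> l"
proof -
  define E where "E = exp (\<kappa> * l)"
  define E' where "E' = exp (\<kappa>' * l)"
  have E1: "E > 1" "E' > E" using assms by (simp_all add: E_def E'_def)
  have "(E - 1) / (E + 1) < (E' - 1) / (E' + 1)" using E1 by (simp add: field_simps)
  then have "\<kappa> * ((E - 1) / (E + 1)) < \<kappa>' * ((E' - 1) / (E' + 1))"
    using assms E1 by (intro mult_strict_mono) auto
  then show ?thesis by (simp add: even_coeff_def E_def E'_def)
qed

text \<open>The derivative of \<open>y coth (y/2)\<close> is \<open>(sinh y - y) / (cosh y - 1)\<close>.\<close>
lemma y_coth_strict_mono:
  fixes y y' :: real
  assumes "0 < y" "y < y'"
  shows "y * ((exp y + 1) / (exp y - 1)) < y' * ((exp y' + 1) / (exp y' - 1))"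
proof (rule DERIV_pos_imp_increasing[OF assms(2)])
  fix z assume "y \<le> z" "z \<le> y'"
  then have z: "z > 0" using assms by simp
  have E: "exp z - 1 > 0" using z by simp
  \<comment> \<open>\<open>h z\<close> is 2(sinh z - z); multiplied by \<open>exp z\<close> it is
    the numerator of the derivative.\<close>
  define h where "h z = exp z - exp (- z) - 2 * z" for z :: real
  have "h 0 < h z"
  proof (rule DERIV_pos_imp_increasing_open[OF z])
    fix w :: real assume w: "0 < w" "w < z"
    have "0 < (exp (w / 2) - exp (- (w / 2)))\<^sup>2" using w by simp
    also have "\<dots> = exp w + exp (- w) - 2"
      by (simp add: power2_diff flip: exp_double exp_add)
    finally have "exp w + exp (- w) - 2 > 0" .
    moreover have "(h has_real_derivative exp w + exp (- w) - 2) (at w)"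
      unfolding h_def by (auto intro!: derivative_eq_intros)
    ultimately show "\<exists>d. (h has_real_derivative d) (at w) \<and> d > 0" by blast
  qed (auto simp: h_def intro!: continuous_intros)
  then have "h z > 0" by (simp add: h_def)
  then have "0 < exp z * h z" by simp
  then have pos: "0 < exp z * exp z - 1 - 2 * z * exp z"
    by (simp add: h_def algebra_simps flip: exp_add)
  have "((\<lambda>z. z * ((exp z + 1) / (exp z - 1))) has_real_derivative
     (exp z * exp z - 1 - 2 * z * exp z) / (exp z - 1)\<^sup>2) (at z)"
    using E by (auto intro!: derivative_eq_intros simp: field_simps power2_eq_square)
  moreover have "0 < (exp z * exp z - 1 - 2 * z * exp z) / (exp z - 1)\<^sup>2"
    using pos E by simp
  ultimately show "\<exists>d. ((\<lambda>z. z * ((exp z + 1) / (exp z - 1))) has_real_derivative d) (at z) \<and> d > 0"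
    by blast
qed

lemma odd_coeff_eq: "l > 0 \<Longrightarrow> odd_coeff \<kappa> l = - (\<kappa> * l * ((exp (\<kappa> * l) + 1) / (exp (\<kappa> * l) - 1))) / l"
  by (simp add: odd_coeff_def)

lemma odd_coeff_strict_antimono:
  assumes "0 < \<kappa>" "\<kappa> < \<kappa>'" "l > 0"
  shows "odd_coeff \<kappa>' l < odd_coeff \<kappa> l"
  unfolding odd_coeff_eq[OF assms(3)]
  using y_coth_strict_mono[of "\<kappa> * l" "\<kappa>' * l"] assms by (intro divide_strict_right_mono) auto

text \<open>The bound is the odd entry of M(0,a), the limit as \<kappa> tends to 0. Clearing
  denominators with y = \<kappa>l leaves h(y) > 0 = h(0), where h' > 0 is 1 - w < exp(-w) in
  disguise.\<close>

lemma odd_coeff_less: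
  assumes "\<kappa> > 0" "l > 0" shows "odd_coeff \<kappa> l < - (2 / l)"
proof -
  define h where "h y = y * (exp y + 1) - 2 * (exp y - 1)" for y :: real
  have y: "0 < \<kappa> * l" using assms by simp
  have "h 0 < h (\<kappa> * l)"
  proof (rule DERIV_pos_imp_increasing_open[OF y])
    fix w :: real assume w: "0 < w" "w < \<kappa> * l"
    have "1 - w < exp (- w)" using exp_minus_greater[of w] w by simp
    then have "exp w * (1 - w) < exp w * exp (- w)" by (intro mult_strict_left_mono) auto
    then have "w * exp w + 1 - exp w > 0" by (simp add: algebra_simps flip: exp_add)
    moreover have "(h has_real_derivative w * exp w + 1 - exp w) (at w)"
      unfolding h_def by (auto intro!: derivative_eq_intros simp: algebra_simps)
    ultimately show "\<exists>d. (h has_real_derivative d) (at w) \<and> d > 0" by blast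
  qed (auto simp: h_def intro!: continuous_intros)
  then have h: "2 * (exp (\<kappa> * l) - 1) < \<kappa> * l * (exp (\<kappa> * l) + 1)" by (simp add: h_def)
  have "exp (\<kappa> * l) - 1 > 0" using assms by simp
  then have "2 < \<kappa> * l * ((exp (\<kappa> * l) + 1) / (exp (\<kappa> * l) - 1))"
    using h by (simp add: field_simps)
  then have "2 / l < \<kappa> * l * ((exp (\<kappa> * l) + 1) / (exp (\<kappa> * l) - 1)) / l"
    using assms by (intro divide_strict_right_mono) auto
  then show ?thesis by (simp add: odd_coeff_eq[OF assms(2)])
qed

lemma coeff_tendsto:
  assumes "\<kappa> > 0" "l > 0"
  shows "((\<lambda>\<kappa>. even_coeff \<kappa> l) \<longlongrightarrow> even_coeff \<kappa> l) (at \<kappa> within S)"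
    and "((\<lambda>\<kappa>. odd_coeff \<kappa> l) \<longlongrightarrow> odd_coeff \<kappa> l) (at \<kappa> within S)"
proof -
  have "exp (\<kappa> * l) + 1 \<noteq> 0" by (metis add_pos_pos exp_gt_zero less_irrefl zero_less_one)
  then show "((\<lambda>\<kappa>. even_coeff \<kappa> l) \<longlongrightarrow> even_coeff \<kappa> l) (at \<kappa> within S)"
    unfolding even_coeff_def by (intro tendsto_intros) auto
  have "exp (\<kappa> * l) - 1 \<noteq> 0" using assms by simp
  then show "((\<lambda>\<kappa>. odd_coeff \<kappa> l) \<longlongrightarrow> odd_coeff \<kappa> l) (at \<kappa> within S)"
    unfolding odd_coeff_def by (intro tendsto_intros) auto
qed

lemma finite_strict_gap:
  fixes f g :: "'a \<Rightarrow> real"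
  assumes "finite S" "\<And>i. i \<in> S \<Longrightarrow> f i < g i"
  shows "\<exists>\<eta>>0. \<forall>i\<in>S. f i \<le> g i - \<eta>"
proof (intro exI conjI ballI)
  \<comment> \<open>The element 1 provides a gap even for empty \<open>S\<close>, as in a graph
    without internal edges.\<close>
  let ?D = "insert 1 ((\<lambda>i. g i - f i) ` S)"
  have "Min ?D \<in> ?D" using assms by (intro Min_in) auto
  then show "Min ?D > 0" using assms(2) by auto
  fix i assume "i \<in> S"
  then have "Min ?D \<le> g i - f i" using assms(1) by (intro Min_le) auto
  then show "f i \<le> g i - Min ?D" by simp
qed

section \<open>Counting eigenvalues\<close>

lemma (in hermitian_on) count_ge_eventually_0: "\<exists>C. \<forall>c\<ge>C. count_ge c = 0"
proof (intro exI allI impI)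
  let ?E = "SOME E. eigenbasis E"
  have fin: "finite ?E" using eigenbasisD(1)[OF eigenbasis_some] .
  fix c assume c: "c \<ge> Max (insert 0 (eigval ` ?E)) + 1"
  have "eigval e < c" if "e \<in> ?E" for e
  proof -
    have "eigval e \<le> Max (insert 0 (eigval ` ?E))" using that fin by (intro Max_ge) auto
    then show ?thesis using c by simp
  qed
  then have "{e \<in> ?E. c \<le> eigval e} = {}" by force
  then show "count_ge c = 0" unfolding count_ge_def by (simp only: card.empty)
qed

lemma size_filter_le_eq:
  "size (filter_mset (\<lambda>x. c \<le> x) M) = size (filter_mset (\<lambda>x. c < x) M) + count M (c::real)"
  by (induction M) auto

text \<open>In a decreasing list the entries at least \<open>c\<close> form an initial segment. This
  is the passage between ordered lists and counting functions.\<close>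

lemma less_size_filter_iff:
  fixes xs :: "real list"
  assumes "sorted_wrt (\<ge>) xs"
  shows "i < size (filter_mset (\<lambda>x. c \<le> x) (mset xs)) \<longleftrightarrow> i < length xs \<and> c \<le> xs ! i"
  using assms
proof (induction xs arbitrary: i)
  case (Cons x xs)
  show ?case
  proof (cases "c \<le> x")
    case True
    then show ?thesis using Cons by (cases i) auto
  next
    case False
    then have "filter_mset (\<lambda>x. c \<le> x) (mset xs) = {#}"
      using Cons.prems by auto
    moreover have "\<not> c \<le> (x # xs) ! i" if "i < length (x # xs)"
    proof -
      have "(x # xs) ! i \<in> set (x # xs)" using that by (rule nth_mem)
      then show ?thesis using Cons.prems False by auto
    qed
    ultimately show ?thesis using False by (auto simp del: filter_mset_eq_mempty_iff)
  qed
qed simp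

section \<open>Comparison of the counting functions\<close>

context graph_bc
begin

abbreviation "cge e s t \<equiv> hermitian_on.count_ge (Kdim m k) V (compressed_sum (even_odd_mat m k e s t))"

definition dtn_count :: "real \<Rightarrow> nat" where
  "dtn_count \<kappa> = hermitian_on.count_ge (Kdim m k) V (compressed_sum (DtN m k a \<kappa>)) 0"

lemma dtn_count_eq: "dtn_count \<kappa> = cge (- \<kappa>) (\<lambda>q. even_coeff \<kappa> (a q)) (\<lambda>q. odd_coeff \<kappa> (a q)) 0"
  by (simp add: dtn_count_def DtN_def)

text \<open>L contributes the same amount to both forms, so only the shifted coefficients have to be
  compared.\<close>

lemma cge_mono:
  assumes "e - c \<le> e' - d" "\<And>q. q < k \<Longrightarrow> s q - c \<le> s' q - d" "\<And>q. q < k \<Longrightarrow> t q - c \<le> t' q - d"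
  shows "cge e s t c \<le> cge e' s' t' d"
proof (rule count_ge_mono[OF hermitian_on_even_odd hermitian_on_even_odd])
  fix x assume x: "x \<in> V"
  show "Re (kinner (Kdim m k) (compressed_sum (even_odd_mat m k e s t) x) x) - c * Re (kinner (Kdim m k) x x)
     \<le> Re (kinner (Kdim m k) (compressed_sum (even_odd_mat m k e' s' t') x) x) - d * Re (kinner (Kdim m k) x x)"
    unfolding kinner_compressed_sum[OF x x]
    using even_odd_mat_form_le[where x = x and m = m, OF assms] by simp
qed

text \<open>On each internal edge M(0,a) annihilates even vectors and multiplies odd ones by
  -2/a.\<close>

lemma L0a_eq: "L0a m k a A B = compressed_sum (even_odd_mat m k 0 (\<lambda>_. 0) (\<lambda>q. - (2 / a q)))"
proof -
  have "M0 m k a = even_odd_mat m k 0 (\<lambda>_. 0) (\<lambda>q. - (2 / a q))"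
    by (intro ext) (auto simp: M0_def even_odd_mat_def diff_divide_distrib algebra_simps)
  then show ?thesis by (intro ext) (simp add: L0a_def compressed_sum_def)
qed

lemma R0a_eq: "R0a m k a A B = compressed_sum (even_odd_mat m k 0 (\<lambda>q. 2 / a q) (\<lambda>_. 0))"
proof -
  have "M1 m k a = even_odd_mat m k 0 (\<lambda>q. 2 / a q) (\<lambda>_. 0)"
    by (intro ext) (auto simp: M1_def even_odd_mat_def add_divide_distrib algebra_simps)
  then show ?thesis by (intro ext) (simp add: R0a_def compressed_sum_def)
qed

abbreviation "countL \<equiv> hermitian_on.count_ge (Kdim m k) V (L0a m k a A B)"
abbreviation "countR \<equiv> hermitian_on.count_ge (Kdim m k) V (R0a m k a A B)"

lemma countL_le_dtn_count:
  assumes "\<kappa> > 0" shows "countL \<kappa> \<le> dtn_count \<kappa>"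
  unfolding L0a_eq dtn_count_eq
proof (rule cge_mono)
  fix q assume "q < k"
  then have l: "a q > 0" using lengths by simp
  show "0 - \<kappa> \<le> even_coeff \<kappa> (a q) - 0" using even_coeff_bounds(1)[OF assms l] by simp
  show "- (2 / a q) - \<kappa> \<le> odd_coeff \<kappa> (a q) - 0" using odd_coeff_bounds(1)[OF assms l] by simp
qed simp

lemma dtn_count_le_countR:
  assumes "\<kappa> > 0" shows "dtn_count \<kappa> \<le> countR \<kappa>"
  unfolding R0a_eq dtn_count_eq
proof (rule cge_mono)
  fix q assume "q < k"
  then have l: "a q > 0" using lengths by simp
  show "even_coeff \<kappa> (a q) - 0 \<le> 2 / a q - \<kappa>" using even_coeff_bounds(2)[OF assms l] by simp
  show "odd_coeff \<kappa> (a q) - 0 \<le> 0 - \<kappa>" using odd_coeff_bounds(2)[OF assms l] by simp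
qed simp

text \<open>M(\<kappa>) lies strictly below M(0,a), uniformly over finitely many coefficients, so
  nonnegative eigenvalues of \<open>L(\<kappa>)\<close> yield eigenvalues of L(0,a) above some
  \<eta> > 0.\<close>

lemma dtn_count_le_countL_pos:
  assumes "\<kappa> > 0" shows "\<exists>\<eta>>0. dtn_count \<kappa> \<le> countL \<eta>"
proof -
  obtain \<eta>1 where e1: "\<eta>1 > 0" "\<And>q. q < k \<Longrightarrow> even_coeff \<kappa> (a q) \<le> 0 - \<eta>1"
    using finite_strict_gap[of "{..<k}" "\<lambda>q. even_coeff \<kappa> (a q)" "\<lambda>_. 0"]
      even_coeff_bounds(3)[OF assms] lengths by auto
  obtain \<eta>2 where e2: "\<eta>2 > 0" "\<And>q. q < k \<Longrightarrow> odd_coeff \<kappa> (a q) \<le> - (2 / a q) - \<eta>2"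
    using finite_strict_gap[of "{..<k}" "\<lambda>q. odd_coeff \<kappa> (a q)" "\<lambda>q. - (2 / a q)"]
      odd_coeff_less[OF assms] lengths by auto
  \<comment> \<open>The term \<kappa> in the minimum handles the external coordinates, which require
    -\<kappa> \<le> 0 - \<eta>.\<close>
  define \<eta> where "\<eta> = min \<kappa> (min \<eta>1 \<eta>2)"
  have le: "\<eta> \<le> \<kappa>" "\<eta> \<le> \<eta>1" "\<eta> \<le> \<eta>2" and pos: "\<eta> > 0" using assms e1 e2 by (auto simp: \<eta>_def)
  have "dtn_count \<kappa> \<le> countL \<eta>"
    unfolding L0a_eq dtn_count_eq
  proof (rule cge_mono)
    fix q assume q: "q < k"
    show "even_coeff \<kappa> (a q) - 0 \<le> 0 - \<eta>" using e1(2)[OF q] le by linarith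
    show "odd_coeff \<kappa> (a q) - 0 \<le> - (2 / a q) - \<eta>" using e2(2)[OF q] le by linarith
  qed (use le in simp)
  then show ?thesis using pos by blast
qed

text \<open>Going down from \<kappa>' to \<kappa> raises every coefficient by at least some \<eta> >
  0, which pushes eigenvalues that were at least 0 strictly above 0.\<close>

lemma dtn_count_strict:
  assumes "0 < \<kappa>" "\<kappa> < \<kappa>'"
  shows "dtn_count \<kappa>' \<le> hermitian_on.count_gt (Kdim m k) V (compressed_sum (DtN m k a \<kappa>)) 0"
proof -
  interpret T: hermitian_on "Kdim m k" V "compressed_sum (DtN m k a \<kappa>)" by (rule hermitian_on_DtN)
  obtain \<eta>1 where e1: "\<eta>1 > 0" "\<And>q. q < k \<Longrightarrow> even_coeff \<kappa>' (a q) \<le> even_coeff \<kappa> (a q) - \<eta>1"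
    using finite_strict_gap[of "{..<k}" "\<lambda>q. even_coeff \<kappa>' (a q)" "\<lambda>q. even_coeff \<kappa> (a q)"]
      even_coeff_strict_antimono[OF assms] lengths by auto
  obtain \<eta>2 where e2: "\<eta>2 > 0" "\<And>q. q < k \<Longrightarrow> odd_coeff \<kappa>' (a q) \<le> odd_coeff \<kappa> (a q) - \<eta>2"
    using finite_strict_gap[of "{..<k}" "\<lambda>q. odd_coeff \<kappa>' (a q)" "\<lambda>q. odd_coeff \<kappa> (a q)"]
      odd_coeff_strict_antimono[OF assms] lengths by auto
  define \<eta> where "\<eta> = min (\<kappa>' - \<kappa>) (min \<eta>1 \<eta>2)"
  have le: "\<eta> \<le> \<kappa>' - \<kappa>" "\<eta> \<le> \<eta>1" "\<eta> \<le> \<eta>2" and pos: "\<eta> > 0" using assms e1 e2 by (auto simp: \<eta>_def)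
  have "dtn_count \<kappa>' \<le> T.count_ge \<eta>"
    unfolding dtn_count_eq unfolding DtN_def
  proof (rule cge_mono)
    fix q assume q: "q < k"
    show "even_coeff \<kappa>' (a q) - 0 \<le> even_coeff \<kappa> (a q) - \<eta>" using e1(2)[OF q] le by linarith
    show "odd_coeff \<kappa>' (a q) - 0 \<le> odd_coeff \<kappa> (a q) - \<eta>" using e2(2)[OF q] le by linarith
  qed (use le in simp)
  also have "\<dots> \<le> T.count_gt 0" by (rule T.count_ge_le_count_gt[OF pos])
  finally show ?thesis .
qed

lemma dtn_coeffs_eventually_close:
  assumes "\<kappa> > 0" "\<delta> > 0"
  shows "\<forall>\<^sub>F \<kappa>' in at \<kappa> within S. \<bar>\<kappa>' - \<kappa>\<bar> < \<delta> \<and>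
    (\<forall>q\<in>{..<k}. \<bar>even_coeff \<kappa>' (a q) - even_coeff \<kappa> (a q)\<bar> < \<delta> \<and>
       \<bar>odd_coeff \<kappa>' (a q) - odd_coeff \<kappa> (a q)\<bar> < \<delta>)"
proof (intro eventually_conj eventually_ball_finite ballI)
  show "\<forall>\<^sub>F \<kappa>' in at \<kappa> within S. \<bar>\<kappa>' - \<kappa>\<bar> < \<delta>"
    using tendstoD[OF tendsto_ident_at[of \<kappa> S] assms(2)] by (simp add: dist_real_def)
  fix q assume "q \<in> {..<k}"
  then have l: "a q > 0" using lengths by simp
  show "\<forall>\<^sub>F \<kappa>' in at \<kappa> within S. \<bar>even_coeff \<kappa>' (a q) - even_coeff \<kappa> (a q)\<bar> < \<delta>"
    using tendstoD[OF coeff_tendsto(1)[OF assms(1) l] assms(2)] by (simp add: dist_real_def)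
  show "\<forall>\<^sub>F \<kappa>' in at \<kappa> within S. \<bar>odd_coeff \<kappa>' (a q) - odd_coeff \<kappa> (a q)\<bar> < \<delta>"
    using tendstoD[OF coeff_tendsto(2)[OF assms(1) l] assms(2)] by (simp add: dist_real_def)
qed simp

text \<open>Let \<delta> be a spectral gap of \<open>L(\<kappa>)\<close> at 0. Coefficients within
  \<delta> of those at \<kappa> give one inequality on each side of \<kappa>, and strict
  monotonicity gives the reverse one.\<close>

lemma dtn_count_local:
  assumes "\<kappa> > 0"
  shows "\<forall>\<^sub>F \<kappa>' in at \<kappa> within {0<..}. dtn_count \<kappa>' =
    (if \<kappa>' < \<kappa> then dtn_count \<kappa>
     else hermitian_on.count_gt (Kdim m k) V (compressed_sum (DtN m k a \<kappa>)) 0)"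
proof -
  interpret T: hermitian_on "Kdim m k" V "compressed_sum (DtN m k a \<kappa>)" by (rule hermitian_on_DtN)
  obtain \<delta> where d: "\<delta> > 0" "T.count_ge (0 - \<delta>) = T.count_ge 0" "T.count_ge (0 + \<delta>) = T.count_gt 0"
    using T.count_ge_gap[of 0] by blast
  have pos: "\<forall>\<^sub>F \<kappa>' in at \<kappa> within {0<..}. \<kappa>' \<in> {0<..} \<and> \<kappa>' \<noteq> \<kappa>"
    by (auto simp: eventually_at_filter)
  show ?thesis
    using dtn_coeffs_eventually_close[OF assms d(1), of "{0<..}"] pos
  proof eventually_elim
    case (elim \<kappa>')
    then have \<kappa>': "\<kappa>' > 0" "\<kappa>' \<noteq> \<kappa>" by auto
    have close: "\<bar>\<kappa>' - \<kappa>\<bar> < \<delta>"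
      "\<And>q. q < k \<Longrightarrow> \<bar>even_coeff \<kappa>' (a q) - even_coeff \<kappa> (a q)\<bar> < \<delta>"
      "\<And>q. q < k \<Longrightarrow> \<bar>odd_coeff \<kappa>' (a q) - odd_coeff \<kappa> (a q)\<bar> < \<delta>"
      using elim by auto
    show ?case
    proof (cases "\<kappa>' < \<kappa>")
      case True
      have "dtn_count \<kappa>' \<le> T.count_ge (0 - \<delta>)"
        unfolding dtn_count_eq unfolding DtN_def
      proof (rule cge_mono)
        fix q assume q: "q < k"
        show "even_coeff \<kappa>' (a q) - 0 \<le> even_coeff \<kappa> (a q) - (0 - \<delta>)" using close(2)[OF q] by linarith
        show "odd_coeff \<kappa>' (a q) - 0 \<le> odd_coeff \<kappa> (a q) - (0 - \<delta>)" using close(3)[OF q] by linarith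
      qed (use close(1) in linarith)
      then have "dtn_count \<kappa>' \<le> dtn_count \<kappa>" using d by (simp add: dtn_count_def)
      moreover have "dtn_count \<kappa> \<le> dtn_count \<kappa>'"
        using dtn_count_strict[OF \<kappa>'(1) True]
          hermitian_on.count_gt_le_count_ge[OF hermitian_on_DtN, of \<kappa>' 0]
        by (simp add: dtn_count_def)
      ultimately show ?thesis using True by simp
    next
      case False
      then have lt: "\<kappa> < \<kappa>'" using \<kappa>' by simp
      have "T.count_ge (0 + \<delta>) \<le> dtn_count \<kappa>'"
        unfolding dtn_count_eq unfolding DtN_def
      proof (rule cge_mono)
        fix q assume q: "q < k"
        show "even_coeff \<kappa> (a q) - (0 + \<delta>) \<le> even_coeff \<kappa>' (a q) - 0" using close(2)[OF q] by linarith
        show "odd_coeff \<kappa> (a q) - (0 + \<delta>) \<le> odd_coeff \<kappa>' (a q) - 0" using close(3)[OF q] by linarith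
      qed (use close(1) in linarith)
      then show ?thesis using dtn_count_strict[OF assms lt] d False by simp
    qed
  qed
qed

text \<open>Both sides are integer step functions of \<open>\<kappa>\<close> that vanish for large \<open>\<kappa>\<close>, are left
  continuous, and drop at \<open>\<kappa>\<close> by the multiplicity of the eigenvalue \<open>-\<kappa>\<^sup>2\<close>; their difference
  is therefore locally constant on \<open>(0,\<infinity>)\<close>.\<close>
lemma dtn_count_eq_size:
  assumes ks: "neg_eigs_kappas m k a A B ks" and \<kappa>: "\<kappa> > 0"
  shows "dtn_count \<kappa> = size (filter_mset (\<lambda>x. \<kappa> \<le> x) (mset ks))"
proof -
  define g where "g \<kappa> = size (filter_mset (\<lambda>x. \<kappa> \<le> x) (mset ks))" for \<kappa>
  have dim: "count (mset ks) \<kappa> = K.dim (op_eigenspace (compressed_sum (DtN m k a \<kappa>)) V 0)"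
    if "\<kappa> > 0" for \<kappa>
    using ks that dim_Delta_eigenspace[OF that] by (simp add: neg_eigs_kappas_def)
  have local: "\<forall>\<^sub>F \<kappa>' in at \<kappa> within {0<..}.
      int (dtn_count \<kappa>) - int (g \<kappa>) = int (dtn_count \<kappa>') - int (g \<kappa>')" if \<kappa>: "\<kappa> > 0" for \<kappa>
  proof -
    interpret T: hermitian_on "Kdim m k" V "compressed_sum (DtN m k a \<kappa>)" by (rule hermitian_on_DtN)
    have f: "dtn_count \<kappa> = T.count_gt 0 + count (mset ks) \<kappa>"
      unfolding dtn_count_def T.count_ge_eq_count_gt_plus_dim dim[OF \<kappa>] ..
    have "\<forall>\<^sub>F \<kappa>' in at \<kappa> within {0<..}. x \<noteq> \<kappa> \<longrightarrow> (\<kappa>' \<le> x \<longleftrightarrow> \<kappa> < x)" for x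
    proof (cases x \<kappa> rule: linorder_cases)
      case less
      have "\<forall>\<^sub>F \<kappa>' in at \<kappa> within {0<..}. x < \<kappa>'" by (rule order_tendstoD(1)[OF tendsto_ident_at less])
      then show ?thesis by eventually_elim (use less in auto)
    next
      case greater
      have "\<forall>\<^sub>F \<kappa>' in at \<kappa> within {0<..}. \<kappa>' < x" by (rule order_tendstoD(2)[OF tendsto_ident_at greater])
      then show ?thesis by eventually_elim (use greater in auto)
    qed simp
    \<comment> \<open>Near \<kappa> the other entries of \<open>ks\<close> keep their side; only the
      copies of \<kappa> itself change status.\<close>
    then have ev: "\<forall>\<^sub>F \<kappa>' in at \<kappa> within {0<..}. \<forall>x\<in>set ks. x \<noteq> \<kappa> \<longrightarrow> (\<kappa>' \<le> x \<longleftrightarrow> \<kappa> < x)"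
      by (intro eventually_ball_finite) auto
    have ne: "\<forall>\<^sub>F \<kappa>' in at \<kappa> within {0<..}. \<kappa>' \<noteq> \<kappa>"
      by (auto simp: eventually_at_filter)
    show ?thesis
      using dtn_count_local[OF \<kappa>] ev ne
    proof eventually_elim
      case (elim \<kappa>')
      show ?case
      proof (cases "\<kappa>' < \<kappa>")
        case True
        have "filter_mset (\<lambda>x. \<kappa>' \<le> x) (mset ks) = filter_mset (\<lambda>x. \<kappa> \<le> x) (mset ks)"
          by (rule filter_mset_cong[OF refl]) (use elim(2) True in force)
        then show ?thesis using elim(1) True by (simp add: g_def)
      next
        case False
        have "filter_mset (\<lambda>x. \<kappa>' \<le> x) (mset ks) = filter_mset (\<lambda>x. \<kappa> < x) (mset ks)"
          by (rule filter_mset_cong[OF refl]) (use elim(2,3) False in force)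
        then have "g \<kappa> = g \<kappa>' + count (mset ks) \<kappa>" by (simp add: g_def size_filter_le_eq)
        then show ?thesis using elim(1) False f by simp
      qed
    qed
  qed
  interpret R: hermitian_on "Kdim m k" V "R0a m k a A B"
    unfolding R0a_eq by (rule hermitian_on_even_odd)
  obtain C where C: "\<forall>c\<ge>C. R.count_ge c = 0" using R.count_ge_eventually_0 by blast
  \<comment> \<open>At \<open>z\<close> both functions vanish: it exceeds every entry of
    \<open>ks\<close>, and it exceeds \<open>C\<close>, beyond which the majorant
    \<open>countR\<close> is 0. The 1 makes it positive.\<close>
  define z where "z = Max (insert 1 (insert C (set ks))) + 1"
  have z: "x < z" if "x \<in> insert 1 (insert C (set ks))" for x
  proof -
    have "x \<le> Max (insert 1 (insert C (set ks)))" using that by (intro Max_ge) auto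
    then show ?thesis by (simp add: z_def)
  qed
  have z0: "z > 0" using z[of 1] by simp
  have "dtn_count z = 0" using dtn_count_le_countR[OF z0] C z[of C] by simp
  moreover have "g z = 0" using z by (force simp: g_def)
  moreover have "int (dtn_count \<kappa>) - int (g \<kappa>) = int (dtn_count z) - int (g z)"
    by (rule connected_local_const[of "{0<..}"]) (use \<kappa> z0 local in auto)
  ultimately have "dtn_count \<kappa> = g \<kappa>" by simp
  then show ?thesis by (simp add: g_def)
qed

end

theorem theorem3p6:
  fixes m k :: nat and a :: "nat \<Rightarrow> real" and A B :: "nat \<Rightarrow> nat \<Rightarrow> complex"
    and ks ls rs :: "real list"
  assumes lengths: "\<forall>q < k. a q > 0"
    and surj: "\<forall>y \<in> Kvecs (Kdim m k). \<exists>u \<in> Kvecs (Kdim m k). \<exists>v \<in> Kvecs (Kdim m k).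
                 mv (Kdim m k) A u + mv (Kdim m k) B v = y"
    and selfadj: "\<forall>i < Kdim m k. \<forall>j < Kdim m k.
                 (\<Sum>l < Kdim m k. A i l * cnj (B j l)) = cnj (\<Sum>l < Kdim m k. A j l * cnj (B i l))"
    and ks: "neg_eigs_kappas m k a A B ks"
    and ls: "pos_eigs_list (L0a m k a A B) (RanPperp (Kdim m k) B) ls"
    and rs: "pos_eigs_list (R0a m k a A B) (RanPperp (Kdim m k) B) rs"
  shows "\<forall>i < length ks. i < length ls \<and> i < length rs \<and> ls ! i \<le> ks ! i \<and> ks ! i \<le> rs ! i"
proof (intro allI impI)
  fix i assume i: "i < length ks"
  interpret graph_bc m k A B a
  proof
    show "\<forall>y \<in> Kvecs (Kdim m k). \<exists>u \<in> Kvecs (Kdim m k). \<exists>v \<in> Kvecs (Kdim m k).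
                 mv (Kdim m k) A u + mv (Kdim m k) B v = y" by (rule surj)
  qed (fact selfadj lengths)+
  interpret Lh: hermitian_on "Kdim m k" V "L0a m k a A B"
    unfolding L0a_eq by (rule hermitian_on_even_odd)
  interpret Rh: hermitian_on "Kdim m k" V "R0a m k a A B"
    unfolding R0a_eq by (rule hermitian_on_even_odd)
  have cntL: "countL c = size (filter_mset (\<lambda>x. c \<le> x) (mset ls))" if "c > 0" for c
    by (rule Lh.count_ge_eq_sum) (use ls that in \<open>auto simp: pos_eigs_list_def\<close>)
  have cntR: "countR c = size (filter_mset (\<lambda>x. c \<le> x) (mset rs))" if "c > 0" for c
    by (rule Rh.count_ge_eq_sum) (use rs that in \<open>auto simp: pos_eigs_list_def\<close>)
  have sks: "sorted_wrt (\<ge>) ks" and sls: "sorted_wrt (\<ge>) ls" and srs: "sorted_wrt (\<ge>) rs"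
    using ks ls rs by (auto simp: neg_eigs_kappas_def pos_eigs_list_def)
  have \<kappa>: "ks ! i > 0" using ks i by (auto simp: neg_eigs_kappas_def)
  \<comment> \<open>Positions start at 0, so at least i + 1 entries are at least
    \<open>ks ! i\<close>.\<close>
  have ik: "i < dtn_count (ks ! i)"
    unfolding dtn_count_eq_size[OF ks \<kappa>] less_size_filter_iff[OF sks] using i by simp
  have "i < countR (ks ! i)" using ik dtn_count_le_countR[OF \<kappa>] by simp
  then have r: "i < length rs" "ks ! i \<le> rs ! i"
    unfolding cntR[OF \<kappa>] less_size_filter_iff[OF srs] by auto
  \<comment> \<open>\<open>ls ! i\<close> has a meaning only once \<open>ls\<close> is known to be
    long enough; \<eta> must be positive because \<open>ls\<close> lists positive eigenvalues
    only.\<close>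
  obtain \<eta> where \<eta>: "\<eta> > 0" "dtn_count (ks ! i) \<le> countL \<eta>"
    using dtn_count_le_countL_pos[OF \<kappa>] by blast
  then have "i < countL \<eta>" using ik by simp
  then have l: "i < length ls" unfolding cntL[OF \<eta>(1)] less_size_filter_iff[OF sls] by auto
  then have l0: "ls ! i > 0" using ls by (auto simp: pos_eigs_list_def)
  \<comment> \<open>For the lower bound the counts are compared at \<open>ls ! i\<close> instead of
    \<open>ks ! i\<close>: more than i of the \<kappa>'s are then at least
    \<open>ls ! i\<close>.\<close>
  have "i < countL (ls ! i)"
    unfolding cntL[OF l0] less_size_filter_iff[OF sls] using l by simp
  then have "i < dtn_count (ls ! i)" using countL_le_dtn_count[OF l0] by simp
  then have "ls ! i \<le> ks ! i"
    unfolding dtn_count_eq_size[OF ks l0] less_size_filter_iff[OF sks] by simp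
  then show "i < length ls \<and> i < length rs \<and> ls ! i \<le> ks ! i \<and> ks ! i \<le> rs ! i"
    using r l by simp
qed

end
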